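(* Assume that $\Omega\subset\mathbb{C}^2$ is a smoothly bounded pseudoconvex domain of finite type $m$. Let $d_{\widetilde K}$ be the distance associated with the Catlin-type metric $\widetilde K$ on $\Omega$. Then there exists a constant $C\ge1$ such that $$g_m(x,y)-C\le d_{\widetilde K}(x,y)\le g_1(x,y)+C$$ for each $x,y\in\Omega$, where for $k\in\{1,m\}$ $$g_k(x,y)=2\log\left(\frac{|x-y|^k+\delta(x)\vee\delta(y)}{\sqrt{\delta(x)\delta(y)}}\right).$$
   Context: $\delta(x)=\inf\{|x-p|:p\in\partial\Omega\}$; $a\vee b=\max\{a,b\}$; $f\asymp g$ means $C^{-1}g\le f\le Cg$ for some constant $C\geq 1$; $N_\varepsilon(\partial\Omega)=\{z\in\Omega:\delta(z)<\varepsilon\}$. Finite type means that each $\xi\in\partial\Omega$ has finite D'Angelo type $m_\xi$. Orthogonal decomposition. For $z\in\Omega$ close enough to $\partial\Omega$ there is a unique $\pi(z)\in\partial\Omega$ with $|z-\pi(z)|=\delta(z)$. With $r$ a defining function and $\langle X,Y\rangle=\sum_kX_k\overline{Y}_k$, let $H_p\partial\Omega=\{X\in\mathbb{C}^2:\langle\bar\partial r(p),X\rangle=0\}$, where $\bar\partial r=(\partial r/\partial\bar z_1,\partial r/\partial\bar z_2)$, and let $N_p\partial\Omega$ be its orthogonal complement. Each $X\in\mathbb{C}^2$, viewed as a tangent vector at $z$, is written $X=X_H+X_N$ with $X_H\in H_{\pi(z)}\partial\Omega$, $X_N\in N_{\pi(z)}\partial\Omega$. Local metric. Given $\xi\in\partial\Omega$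 of type $m_\xi$, after a translation and a rotation (unitary change) of coordinates assume $\xi=0$, the normal direction to $\partial\Omega$ at $\xi$ is the $\operatorname{Im}z_2$-axis, and $\Omega$ is given near $\xi$ by $r<0$ with $r(z_1,z_2)=\operatorname{Im}z_2-F(z_1,\operatorname{Re}z_2)$, $F$ smooth, $F(0)=0$. Put $L_1=\frac{\partial}{\partial z_1}-\left(\frac{\partial r}{\partial z_2}\right)^{-1}\frac{\partial r}{\partial z_1}\frac{\partial}{\partial z_2}$, and for integers $j,k>0$ $$\mathcal{L}_{j,k}(z)=\underbrace{L_1\cdots L_1}_{j-1}\,\underbrace{\bar L_1\cdots\bar L_1}_{k-1}\,\partial\bar\partial r(L_1,\bar L_1)(z),\qquad C_l^\xi(z)=\max\{|\mathcal{L}_{j,k}(z)|:j+k=l\}.$$ (One has $\mathcal{L}_{j,k}(\xi)=0$ for $j+k<m_\xi$ and $\mathcal{L}_{j_0,k_0}(\xi)\ne0$ for some $j_0+k_0=m_\xi$.) For $z\in\Omega$ near $\xi$ set $$\widetilde M_\xi(z,X)=\frac{|X_N|}{\delta(z)}+|X_H|\sum_{l=2}^{m_\xi}\left(\frac{C_l^\xi(z)}{\delta(z)}\right)^{1/l}.$$ Catlin-type metric. Choose points $\xi_1,\dots,\xi_s\in\partial\Omega$ and (sufficiently small) open neighborhoods $U_i$ of $\xi_i$, forming a finite cover of $\partial\Omega$, such that the local metric $\widetilde M_{\xi_i}$ (together with the projection $\pi$, the vector field $L_1$ and the functions $C_l^{\xi_i}$ entering its definition) is defined and $\widetilde M_{\xi_i}\asymp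 K_\Omega$ on $U_i\cap\Omega$, where $K_\Omega$ is the Kobayashi metric $K_\Omega(z;v)=\inf\{|\zeta|:f:\mathbb{D}\to\Omega\text{ holomorphic},f(0)=z,df_0(\zeta)=v\}$, with $\mathbb{D}$ the unit disc. Choose a small $\varepsilon>0$ with $N_\varepsilon(\partial\Omega)\subset\bigcup_iU_i$. For $z\in N_\varepsilon(\partial\Omega)$ let $\widetilde M(z,X)=\max\{\widetilde M_{\xi_i}(z,X):z\in\overline U_i\}$. A Catlin-type metric is a Finsler metric (upper semi-continuous, $F(z;tX)=|t|F(z;X)$ for $t\in\mathbb{C}$) of the form $\widetilde K(z,X)=K_\Omega(z,X)S(z,X)$ on $\Omega$ with $S$ a positive function, $S\asymp1$, and $\widetilde K=\widetilde M$ on $N_\varepsilon(\partial\Omega)$. With $m=\max_im_{\xi_i}$ (this is the type $m$ of $\Omega$), the construction is such that for some constant $C>0$ $$\frac{|X_N|}{\delta(z)}+\frac1C\frac{|X_H|}{\delta(z)^{1/m}}\le\widetilde K(z,X)\le\frac{|X_N|}{\delta(z)}+C\frac{|X_H|}{\delta(z)^{1/2}},\qquad z\in N_\varepsilon(\partial\Omega),\ X\in\mathbb{C}^2.$$ $d_{\widetilde K}(x,y)$ is the infimum of $\int_0^1\widetilde K(\gamma(t);\dot\gamma(t))\,dt$ over piecewise $C^1$ curves $\gamma:[0,1]\to\Omega$ from $x$ to $y$. *)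

theory Defs
  imports "HOL-Analysis.Analysis"
begin

section \<open>Smooth functions and Wirtinger derivatives\<close>

primrec iter_deriv ::
  "'a::real_normed_vector list \<Rightarrow> ('a \<Rightarrow> 'b::real_normed_vector) \<Rightarrow> 'a \<Rightarrow> 'b" where
  "iter_deriv [] f = f"
| "iter_deriv (v # vs) f = (\<lambda>x. frechet_derivative (iter_deriv vs f) (at x) v)"

text \<open>\<open>C\<^sup>\<infinity>\<close>; to be used on open subsets of finite-dimensional spaces.\<close>

definition smooth_on ::
  "'a::real_normed_vector set \<Rightarrow> ('a \<Rightarrow> 'b::real_normed_vector) \<Rightarrow> bool" where
  "smooth_on S f \<longleftrightarrow> (\<forall>vs. \<forall>x\<in>S. iter_deriv vs f differentiable (at x))"

definition dz :: "2 \<Rightarrow> (complex^2 \<Rightarrow> complex) \<Rightarrow> complex^2 \<Rightarrow> complex" where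
  "dz k f z = (frechet_derivative f (at z) (axis k 1)
                - \<i> * frechet_derivative f (at z) (axis k \<i>)) / 2"

definition dzbar :: "2 \<Rightarrow> (complex^2 \<Rightarrow> complex) \<Rightarrow> complex^2 \<Rightarrow> complex" where
  "dzbar k f z = (frechet_derivative f (at z) (axis k 1)
                + \<i> * frechet_derivative f (at z) (axis k \<i>)) / 2"

text \<open>\<open>\<partial>\<partial>\<bar>r(X, \<bar>Y)\<close>.\<close>

definition levi_form ::
  "(complex^2 \<Rightarrow> real) \<Rightarrow> complex^2 \<Rightarrow> complex^2 \<Rightarrow> complex^2 \<Rightarrow> complex" where
  "levi_form r p X Y =
     (\<Sum>j\<in>UNIV. \<Sum>k\<in>UNIV. dz j (dzbar k (\<lambda>z. complex_of_real (r z))) p * X $ j * cnj (Y $ k))"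


section \<open>Smoothly bounded pseudoconvex domains of finite type\<close>

definition hprod :: "complex^2 \<Rightarrow> complex^2 \<Rightarrow> complex" where
  "hprod X Y = (\<Sum>k\<in>UNIV. X $ k * cnj (Y $ k))"

definition dbar_vec :: "(complex^2 \<Rightarrow> real) \<Rightarrow> complex^2 \<Rightarrow> complex^2" where
  "dbar_vec r p = (\<chi> k. dzbar k (\<lambda>z. complex_of_real (r z)) p)"

text \<open>Since \<open>r\<close> is real valued, \<open>dbar_vec r p \<noteq> 0\<close> says that \<open>dr\<close> does not vanish at \<open>p\<close>.\<close>

definition defining_function :: "(complex^2) set \<Rightarrow> (complex^2 \<Rightarrow> real) \<Rightarrow> bool" where
  "defining_function \<Omega> r \<longleftrightarrow>
     (\<exists>W. open W \<and> frontier \<Omega> \<subseteq> W \<and> smooth_on W r \<and>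
          \<Omega> \<inter> W = {z \<in> W. r z < 0} \<and> frontier \<Omega> = {z \<in> W. r z = 0} \<and>
          (\<forall>p\<in>frontier \<Omega>. dbar_vec r p \<noteq> 0))"

definition smoothly_bounded_domain :: "(complex^2) set \<Rightarrow> (complex^2 \<Rightarrow> real) \<Rightarrow> bool" where
  "smoothly_bounded_domain \<Omega> r \<longleftrightarrow>
     open \<Omega> \<and> connected \<Omega> \<and> \<Omega> \<noteq> {} \<and> bounded \<Omega> \<and> defining_function \<Omega> r"

definition H_space :: "(complex^2 \<Rightarrow> real) \<Rightarrow> complex^2 \<Rightarrow> (complex^2) set" where
  "H_space r p = {X. hprod (dbar_vec r p) X = 0}"

definition N_space :: "(complex^2 \<Rightarrow> real) \<Rightarrow> complex^2 \<Rightarrow> (complex^2) set" where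
  "N_space r p = {Y. \<forall>X\<in>H_space r p. hprod X Y = 0}"

text \<open>The Levi form is real on the diagonal, so taking the real part loses nothing.\<close>

definition pseudoconvex :: "(complex^2) set \<Rightarrow> (complex^2 \<Rightarrow> real) \<Rightarrow> bool" where
  "pseudoconvex \<Omega> r \<longleftrightarrow>
     (\<forall>p\<in>frontier \<Omega>. \<forall>X\<in>H_space r p. 0 \<le> Re (levi_form r p X X))"

definition vanishing_order ::
  "('a::real_normed_vector \<Rightarrow> 'b::real_normed_vector) \<Rightarrow> 'a \<Rightarrow> enat" where
  "vanishing_order f x = Sup {enat k |k. \<forall>vs. length vs < k \<longrightarrow> iter_deriv vs f x = 0}"

definition holomorphic_map_on :: "(complex \<Rightarrow> complex^2) \<Rightarrow> complex set \<Rightarrow> bool" where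
  "holomorphic_map_on f S \<longleftrightarrow> (\<forall>k. (\<lambda>t. f t $ k) holomorphic_on S)"

text \<open>D'Angelo type: supremum of \<open>\<nu>(r \<circ> \<gamma>) / \<nu>(\<gamma>)\<close> over the nonconstant holomorphic
  germs \<open>\<gamma>\<close> with \<open>\<gamma>(0) = \<xi>\<close>, where \<open>\<nu>\<close> is the order of vanishing at \<open>0\<close> (of \<open>\<gamma> - \<xi>\<close>
  in the denominator).\<close>

definition dangelo_type :: "(complex^2 \<Rightarrow> real) \<Rightarrow> complex^2 \<Rightarrow> ereal" where
  "dangelo_type r \<xi> =
     Sup {ereal_of_enat (vanishing_order (\<lambda>t. r (\<gamma> t)) 0)
            / ereal_of_enat (vanishing_order (\<lambda>t. \<gamma> t - \<xi>) 0) |\<gamma> e.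
          0 < e \<and> holomorphic_map_on \<gamma> (ball 0 e) \<and> \<gamma> 0 = \<xi> \<and> (\<exists>t\<in>ball 0 e. \<gamma> t \<noteq> \<xi>)}"

definition finite_type :: "(complex^2) set \<Rightarrow> (complex^2 \<Rightarrow> real) \<Rightarrow> nat \<Rightarrow> bool" where
  "finite_type \<Omega> r m \<longleftrightarrow>
     (\<forall>\<xi>\<in>frontier \<Omega>. dangelo_type r \<xi> < \<infinity>) \<and>
     (SUP \<xi>\<in>frontier \<Omega>. dangelo_type r \<xi>) = ereal (real m)"


section \<open>Distance to the boundary and orthogonal decomposition\<close>

definition bdist :: "(complex^2) set \<Rightarrow> complex^2 \<Rightarrow> real" where
  "bdist \<Omega> z = infdist z (frontier \<Omega>)"

definition collar :: "(complex^2) set \<Rightarrow> real \<Rightarrow> (complex^2) set" where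
  "collar \<Omega> \<epsilon> = {z \<in> \<Omega>. bdist \<Omega> z < \<epsilon>}"

definition is_nearest :: "(complex^2) set \<Rightarrow> complex^2 \<Rightarrow> complex^2 \<Rightarrow> bool" where
  "is_nearest \<Omega> z p \<longleftrightarrow> p \<in> frontier \<Omega> \<and> dist z p = bdist \<Omega> z"

definition proj :: "(complex^2) set \<Rightarrow> complex^2 \<Rightarrow> complex^2" where
  "proj \<Omega> z = (THE p. is_nearest \<Omega> z p)"

definition H_part ::
  "(complex^2) set \<Rightarrow> (complex^2 \<Rightarrow> real) \<Rightarrow> complex^2 \<Rightarrow> complex^2 \<Rightarrow> complex^2" where
  "H_part \<Omega> r z X =
     (THE Y. Y \<in> H_space r (proj \<Omega> z) \<and> X - Y \<in> N_space r (proj \<Omega> z))"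

definition N_part ::
  "(complex^2) set \<Rightarrow> (complex^2 \<Rightarrow> real) \<Rightarrow> complex^2 \<Rightarrow> complex^2 \<Rightarrow> complex^2" where
  "N_part \<Omega> r z X = X - H_part \<Omega> r z X"


section \<open>The local metric\<close>

definition unitary_matrix :: "complex^2^2 \<Rightarrow> bool" where
  "unitary_matrix A \<longleftrightarrow> A ** (\<chi> i j. cnj (A $ j $ i)) = mat 1"

definition new_coords :: "complex^2 \<Rightarrow> complex^2^2 \<Rightarrow> complex^2 \<Rightarrow> complex^2" where
  "new_coords \<xi> A z = A *v (z - \<xi>)"

definition graph_fn :: "(complex \<times> real \<Rightarrow> real) \<Rightarrow> complex^2 \<Rightarrow> real" where
  "graph_fn F w = Im (w $ 2) - F (w $ 1, Re (w $ 2))"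

text \<open>In the coordinates \<open>w = A(z - \<xi>)\<close> the set \<open>\<Omega> \<inter> V\<close> is given by
  \<open>Im w\<^sub>2 < F(w\<^sub>1, Re w\<^sub>2)\<close>; the last conjunct says that the gradient of the graph function
  at \<open>0\<close> points along the \<open>Im w\<^sub>2\<close>-axis.\<close>

definition normal_form ::
  "(complex^2) set \<Rightarrow> complex^2 \<Rightarrow> complex^2^2 \<Rightarrow> (complex \<times> real \<Rightarrow> real)
     \<Rightarrow> (complex^2) set \<Rightarrow> bool" where
  "normal_form \<Omega> \<xi> A F V \<longleftrightarrow>
     unitary_matrix A \<and> open V \<and> \<xi> \<in> V \<and>
     smooth_on ((\<lambda>w. (w $ 1, Re (w $ 2))) ` new_coords \<xi> A ` V) F \<and> F (0, 0) = 0 \<and>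
     (\<forall>z\<in>V. z \<in> \<Omega> \<longleftrightarrow> graph_fn F (new_coords \<xi> A z) < 0) \<and>
     (\<exists>c::real. \<forall>v. frechet_derivative (graph_fn F) (at 0) v = c * Im (v $ 2))"

text \<open>\<open>L\<^sub>1 = \<partial>/\<partial>z\<^sub>1 - b \<partial>/\<partial>z\<^sub>2\<close> with \<open>b = (\<partial>r/\<partial>z\<^sub>2)\<^sup>-\<^sup>1 \<partial>r/\<partial>z\<^sub>1\<close>.\<close>

definition L_coeff :: "(complex^2 \<Rightarrow> real) \<Rightarrow> complex^2 \<Rightarrow> complex" where
  "L_coeff r w = inverse (dz 2 (\<lambda>z. complex_of_real (r z)) w) * dz 1 (\<lambda>z. complex_of_real (r z)) w"

definition L1 :: "(complex^2 \<Rightarrow> real) \<Rightarrow> (complex^2 \<Rightarrow> complex) \<Rightarrow> complex^2 \<Rightarrow> complex" where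
  "L1 r g = (\<lambda>w. dz 1 g w - L_coeff r w * dz 2 g w)"

definition L1bar :: "(complex^2 \<Rightarrow> real) \<Rightarrow> (complex^2 \<Rightarrow> complex) \<Rightarrow> complex^2 \<Rightarrow> complex" where
  "L1bar r g = (\<lambda>w. dzbar 1 g w - cnj (L_coeff r w) * dzbar 2 g w)"

definition L1_vec :: "(complex^2 \<Rightarrow> real) \<Rightarrow> complex^2 \<Rightarrow> complex^2" where
  "L1_vec r w = vector [1, - L_coeff r w]"

definition L_jk :: "(complex^2 \<Rightarrow> real) \<Rightarrow> nat \<Rightarrow> nat \<Rightarrow> complex^2 \<Rightarrow> complex" where
  "L_jk r j k =
     (L1 r ^^ (j - 1)) ((L1bar r ^^ (k - 1)) (\<lambda>w. levi_form r w (L1_vec r w) (L1_vec r w)))"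

definition C_l :: "(complex^2 \<Rightarrow> real) \<Rightarrow> nat \<Rightarrow> complex^2 \<Rightarrow> real" where
  "C_l r l w = Max {cmod (L_jk r j k w) |j k. 0 < j \<and> 0 < k \<and> j + k = l}"

definition local_metric ::
  "(complex^2) set \<Rightarrow> (complex^2 \<Rightarrow> real) \<Rightarrow> complex^2 \<Rightarrow> nat \<Rightarrow> complex^2^2
     \<Rightarrow> (complex \<times> real \<Rightarrow> real) \<Rightarrow> complex^2 \<Rightarrow> complex^2 \<Rightarrow> real" where
  "local_metric \<Omega> r \<xi> m\<xi> A F z X =
     norm (N_part \<Omega> r z X) / bdist \<Omega> z
     + norm (H_part \<Omega> r z X)
       * (\<Sum>l=2..m\<xi>. (C_l (graph_fn F) l (new_coords \<xi> A z) / bdist \<Omega> z) powr (1 / real l))"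


section \<open>Catlin-type metrics\<close>

definition kobayashi :: "(complex^2) set \<Rightarrow> complex^2 \<Rightarrow> complex^2 \<Rightarrow> real" where
  "kobayashi \<Omega> z v =
     Inf {cmod \<zeta> |\<zeta> f. holomorphic_map_on f (ball 0 1) \<and> f ` ball 0 1 \<subseteq> \<Omega> \<and> f 0 = z \<and>
                        (\<forall>k. deriv (\<lambda>t. f t $ k) 0 * \<zeta> = v $ k)}"

definition comparable_on :: "'a set \<Rightarrow> ('a \<Rightarrow> real) \<Rightarrow> ('a \<Rightarrow> real) \<Rightarrow> bool" where
  "comparable_on S f g \<longleftrightarrow> (\<exists>C\<ge>1. \<forall>x\<in>S. inverse C * g x \<le> f x \<and> f x \<le> C * g x)"

definition upper_semicontinuous_on :: "'a::topological_space set \<Rightarrow> ('a \<Rightarrow> real) \<Rightarrow> bool" where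
  "upper_semicontinuous_on S f \<longleftrightarrow>
     (\<forall>x\<in>S. \<forall>a. f x < a \<longrightarrow> (\<forall>\<^sub>F y in at x within S. f y < a))"

definition finsler_metric ::
  "(complex^2) set \<Rightarrow> (complex^2 \<Rightarrow> complex^2 \<Rightarrow> real) \<Rightarrow> bool" where
  "finsler_metric \<Omega> K \<longleftrightarrow>
     upper_semicontinuous_on (\<Omega> \<times> UNIV) (\<lambda>(z, X). K z X) \<and>
     (\<forall>z\<in>\<Omega>. \<forall>X. \<forall>t::complex. K z (t *s X) = cmod t * K z X)"

text \<open>The points \<open>\<xi> i\<close>, \<open>i < s\<close>, of type \<open>M i\<close>, with neighbourhoods \<open>U i\<close>. The normal form at
  \<open>\<xi> i\<close> is required on a neighbourhood of the closure of \<open>U i\<close>, because the metric below uses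
  the \<open>i\<close>-th local metric on that closure.\<close>

definition catlin_cover ::
  "(complex^2) set \<Rightarrow> (complex^2 \<Rightarrow> real) \<Rightarrow> nat \<Rightarrow> (nat \<Rightarrow> complex^2) \<Rightarrow> (nat \<Rightarrow> nat)
     \<Rightarrow> (nat \<Rightarrow> complex^2^2) \<Rightarrow> (nat \<Rightarrow> complex \<times> real \<Rightarrow> real) \<Rightarrow> (nat \<Rightarrow> (complex^2) set)
     \<Rightarrow> bool" where
  "catlin_cover \<Omega> r s \<xi> M A F U \<longleftrightarrow>
     frontier \<Omega> \<subseteq> (\<Union>i<s. U i) \<and>
     (\<forall>i<s. \<xi> i \<in> frontier \<Omega> \<and> dangelo_type r (\<xi> i) = ereal (real (M i)) \<and>
        open (U i) \<and> \<xi> i \<in> U i \<and>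
        (\<exists>V. closure (U i) \<subseteq> V \<and> normal_form \<Omega> (\<xi> i) (A i) (F i) V) \<and>
        (\<forall>z\<in>U i \<inter> \<Omega>. \<exists>!p. is_nearest \<Omega> z p) \<and>
        comparable_on ((U i \<inter> \<Omega>) \<times> UNIV)
          (\<lambda>(z, X). local_metric \<Omega> r (\<xi> i) (M i) (A i) (F i) z X)
          (\<lambda>(z, X). kobayashi \<Omega> z X))"

text \<open>The final two-sided bound is the estimate that the construction provides for sufficiently
  small \<open>U i\<close> and \<open>\<epsilon>\<close>; it is recorded as part of the notion.\<close>

definition catlin_type_metric ::
  "(complex^2) set \<Rightarrow> (complex^2 \<Rightarrow> real) \<Rightarrow> nat \<Rightarrow> (complex^2 \<Rightarrow> complex^2 \<Rightarrow> real)
     \<Rightarrow> bool" where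
  "catlin_type_metric \<Omega> r m K \<longleftrightarrow>
     finsler_metric \<Omega> K \<and>
     (\<exists>S. (\<forall>z\<in>\<Omega>. \<forall>X. 0 < S z X \<and> K z X = kobayashi \<Omega> z X * S z X) \<and>
          comparable_on (\<Omega> \<times> UNIV) (\<lambda>(z, X). S z X) (\<lambda>_. 1)) \<and>
     (\<exists>s \<xi> M A F U \<epsilon>.
        catlin_cover \<Omega> r s \<xi> M A F U \<and> m = Max (M ` {..<s}) \<and>
        0 < \<epsilon> \<and> collar \<Omega> \<epsilon> \<subseteq> (\<Union>i<s. U i) \<and>
        (\<forall>z\<in>collar \<Omega> \<epsilon>. \<forall>X.
           K z X = Max {local_metric \<Omega> r (\<xi> i) (M i) (A i) (F i) z X |i.
                          i < s \<and> z \<in> closure (U i)}) \<and>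
        (\<exists>C>0. \<forall>z\<in>collar \<Omega> \<epsilon>. \<forall>X.
           norm (N_part \<Omega> r z X) / bdist \<Omega> z
             + 1 / C * (norm (H_part \<Omega> r z X) / bdist \<Omega> z powr (1 / real m)) \<le> K z X \<and>
           K z X \<le> norm (N_part \<Omega> r z X) / bdist \<Omega> z
             + C * (norm (H_part \<Omega> r z X) / bdist \<Omega> z powr (1 / 2))))"


section \<open>The associated distance\<close>

text \<open>On each closed piece \<open>\<gamma>\<close> is \<open>C\<^sup>1\<close> up to the endpoints. This is stronger than
  \<open>piecewise_C1_differentiable_on\<close>, which lets the derivative blow up at the break points, so
  that the length integrand need not be integrable.\<close>

definition piecewise_C1_curve :: "(real \<Rightarrow> 'a::real_normed_vector) \<Rightarrow> bool" where
  "piecewise_C1_curve \<gamma> \<longleftrightarrow>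
     (\<exists>ts. ts \<noteq> [] \<and> sorted_wrt (<) ts \<and> hd ts = 0 \<and> last ts = 1 \<and>
       (\<forall>i. Suc i < length ts \<longrightarrow>
         (\<exists>\<gamma>'. continuous_on {ts ! i..ts ! Suc i} \<gamma>' \<and>
           (\<forall>t\<in>{ts ! i..ts ! Suc i}.
              (\<gamma> has_vector_derivative \<gamma>' t) (at t within {ts ! i..ts ! Suc i})))))"

definition finsler_dist ::
  "(complex^2) set \<Rightarrow> (complex^2 \<Rightarrow> complex^2 \<Rightarrow> real) \<Rightarrow> complex^2 \<Rightarrow> complex^2 \<Rightarrow> real" where
  "finsler_dist \<Omega> K x y =
     Inf {integral {0..1} (\<lambda>t. K (\<gamma> t) (vector_derivative \<gamma> (at t))) |\<gamma>.
          piecewise_C1_curve \<gamma> \<and> \<gamma> ` {0..1} \<subseteq> \<Omega> \<and> \<gamma> 0 = x \<and> \<gamma> 1 = y}"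

definition g_fn :: "(complex^2) set \<Rightarrow> nat \<Rightarrow> complex^2 \<Rightarrow> complex^2 \<Rightarrow> real" where
  "g_fn \<Omega> k x y =
     2 * ln ((norm (x - y) ^ k + max (bdist \<Omega> x) (bdist \<Omega> y))
             / sqrt (bdist \<Omega> x * bdist \<Omega> y))"

end

theory Submission
  imports Defs
begin

text \<open>
  Lower bound. The distance to the boundary \<open>\<delta>\<close> is differentiable in the collar, with gradient
  the unit normal at the nearest point, so \<open>|d\<delta>(X)| \<le> |X\<^sub>N|\<close>. For a curve of maximal height
  \<open>h\<close>, splitting \<open>1/\<delta> = (1/\<delta> - 1/h) + 1/h\<close> gives
  \<open>K(z, X) \<ge> |d(ln \<delta> - \<delta>/h)(X)| + k |X| / h\<^bsup>1/m\<^esup>\<close>. Integrating up to the highest point and down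
  again yields \<open>2 ln h - ln \<delta>(x) - ln \<delta>(y) - 2 + k |x - y| / h\<^bsup>1/m\<^esup>\<close>, and the last term, linear in
  \<open>A = |x - y| / h\<^bsup>1/m\<^esup>\<close>, dominates \<open>2 ln (1 + A\<^sup>m)\<close> up to a constant.

  Upper bound. Climb along the normals from \<open>x\<close> and \<open>y\<close> to a height comparable to
  \<open>|x - y| + max \<delta>(x) \<delta>(y)\<close> and connect there by a segment of bounded length. A Taylor estimate
  for the defining function provides interior balls of uniform radius, so that \<open>\<delta>\<close> is exactly
  the parameter on the normals and no error accumulates in the logarithm.
\<close>

section \<open>The orthogonal splitting\<close>

text \<open>The logarithms of \<delta>(x) and \<delta>(y) enter \<open>g_fn\<close> with coefficient
  one, so both estimates rely on the exact weight \<open>1 / \<delta>\<close> of normal vectors; a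
  multiplicative error there could not be absorbed by an additive constant. Three obstacles shape
  the rest. No estimate of \<open>K\<close> is at hand outside the collar: a curve that climbs too
  high is therefore compared with a logarithm truncated at a fixed height, without horizontal term,
  which suffices because the numerator of \<open>g_fn\<close> is bounded by the size of \<Omega>; in
  the upper bound, deep or distant points are joined inside a compact set. Inside the collar,
  uniqueness of the nearest point is what is given, so differentiability of \<delta> is derived from
  convergence of nearest points. Finally \<open>K\<close> is merely upper semicontinuous, and
  \<open>integral\<close> has the default value 0, so integrability along curves has to be proved
  before lengths can be estimated from below.\<close>

lemma inner_eq_Re_hprod: "X \<bullet> Y = Re (hprod X Y)"
  by (simp add: inner_vec_def hprod_def inner_complex_def)

lemma hprod_diff_right: "hprod Z (X - Y) = hprod Z X - hprod Z Y"
  and hprod_scale_right: "hprod X (c *s Y) = cnj c * hprod X Y"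
  and cnj_hprod: "cnj (hprod X Y) = hprod Y X"
  by (simp_all add: hprod_def sum_2 algebra_simps)

lemma hprod_self: "hprod X X = complex_of_real ((norm X)\<^sup>2)"
proof (rule complex_eqI)
  show "Re (hprod X X) = Re (complex_of_real ((norm X)\<^sup>2))"
    by (simp add: inner_eq_Re_hprod [symmetric] power2_norm_eq_inner)
qed (simp add: hprod_def)

lemma scaleR_eq_vec_scale: "c *\<^sub>R X = complex_of_real c *s (X :: complex^2)"
  unfolding vec_eq_iff vector_scaleR_component vector_smult_component
  by (simp add: scaleR_conv_of_real)

lemma dbar_scale_in_N_space: "c *s dbar_vec r p \<in> N_space r p"
  unfolding N_space_def H_space_def
  by (auto simp: hprod_scale_right) (metis cnj_hprod complex_cnj_zero)

text \<open>Makes the \<open>THE\<close> in \<open>H_part\<close> meaningful. Existence is Hermitian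
  projection along \<open>dbar_vec r p\<close>; for uniqueness, the difference of two candidates
  lies in \<open>H_space\<close> and is orthogonal to itself.\<close>

lemma orthogonal_splitting_ex1:
  assumes "dbar_vec r p \<noteq> 0"
  shows "\<exists>!Y. Y \<in> H_space r p \<and> X - Y \<in> N_space r p"
proof (rule ex_ex1I)
  define g where "g = dbar_vec r p"
  \<comment> \<open>\<open>hprod\<close> is conjugate-linear in its second argument, so conjugating
    \<open>c\<close> turns \<open>hprod X g\<close> into \<open>hprod g X\<close>, as the next
    identity needs.\<close>
  define c where "c = hprod X g / hprod g g"
  have "hprod g (X - c *s g) = 0"
    using assms
    by (simp add: c_def hprod_diff_right hprod_scale_right cnj_hprod hprod_self g_def)
  then have "X - c *s g \<in> H_space r p"
    by (simp add: H_space_def g_def)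
  moreover have "X - (X - c *s g) \<in> N_space r p"
    using dbar_scale_in_N_space [of c r p] by (simp add: g_def)
  ultimately show "\<exists>Y. Y \<in> H_space r p \<and> X - Y \<in> N_space r p"
    by blast
next
  fix Y Z
  assume Y: "Y \<in> H_space r p \<and> X - Y \<in> N_space r p"
    and Z: "Z \<in> H_space r p \<and> X - Z \<in> N_space r p"
  have H: "Y - Z \<in> H_space r p"
    using Y Z by (simp add: H_space_def hprod_diff_right)
  then have "hprod (Y - Z) (X - Y) = 0" "hprod (Y - Z) (X - Z) = 0"
    using Y Z by (auto simp: N_space_def)
  then have "hprod (Y - Z) (Y - Z) = 0"
    by (simp add: hprod_diff_right)
  then show "Y = Z"
    by (simp add: hprod_self)
qed

context
  fixes \<Omega> :: "(complex^2) set" and r :: "complex^2 \<Rightarrow> real" and z p :: "complex^2"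
  assumes proj: "proj \<Omega> z = p" and dbar: "dbar_vec r p \<noteq> 0"
begin

lemma H_part_in_H_space: "H_part \<Omega> r z X \<in> H_space r p"
  and N_part_in_N_space: "N_part \<Omega> r z X \<in> N_space r p"
  using theI' [OF orthogonal_splitting_ex1 [OF dbar]]
  by (simp_all add: H_part_def N_part_def proj)

lemma norm_parts: "(norm X)\<^sup>2 = (norm (H_part \<Omega> r z X))\<^sup>2 + (norm (N_part \<Omega> r z X))\<^sup>2"
proof -
  have "H_part \<Omega> r z X \<bullet> N_part \<Omega> r z X = 0"
    using H_part_in_H_space N_part_in_N_space
    by (simp add: inner_eq_Re_hprod N_space_def)
  then show ?thesis
    using norm_add_Pythagorean [of "H_part \<Omega> r z X" "N_part \<Omega> r z X"]
    by (simp add: N_part_def orthogonal_def)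
qed

lemma norm_H_part_le: "norm (H_part \<Omega> r z X) \<le> norm X"
  and norm_N_part_le: "norm (N_part \<Omega> r z X) \<le> norm X"
  using norm_parts [of X] by (auto intro: power2_le_imp_le)

lemma norm_le_parts: "norm X \<le> norm (H_part \<Omega> r z X) + norm (N_part \<Omega> r z X)"
  using norm_triangle_ineq [of "H_part \<Omega> r z X" "N_part \<Omega> r z X"] by (simp add: N_part_def)

text \<open>The real differential of \<open>r\<close> at \<open>p\<close> sees only the normal
  component; this later bounds the differential of the boundary distance by the norm of
  \<open>N_part\<close>.\<close>

lemma inner_dbar_eq_N_part: "dbar_vec r p \<bullet> X = dbar_vec r p \<bullet> N_part \<Omega> r z X"
  using H_part_in_H_space [of X]
  by (simp add: N_part_def hprod_diff_right inner_eq_Re_hprod H_space_def)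

text \<open>Motion along the normal has no horizontal part, so the constant \<open>C\<close> of the
  metric bound disappears there and lengths along normals stay sharp.\<close>

lemma H_part_dbar: "H_part \<Omega> r z (c *\<^sub>R dbar_vec r p) = 0"
  unfolding H_part_def proj scaleR_eq_vec_scale
  by (rule the1_equality [OF orthogonal_splitting_ex1 [OF dbar]])
    (use dbar_scale_in_N_space in \<open>auto simp: H_space_def hprod_def\<close>)

end

section \<open>Uniform Taylor estimate\<close>

lemma smooth_on_differentiable: "smooth_on W f \<Longrightarrow> x \<in> W \<Longrightarrow> f differentiable (at x)"
  unfolding smooth_on_def by (metis iter_deriv.simps(1))

text \<open>Appending \<open>v\<close> at the end of the list differentiates in direction
  \<open>v\<close> first, so iterated derivatives of a directional derivative are iterated
  derivatives of \<open>f\<close>.\<close>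

lemma smooth_on_frechet:
  assumes "smooth_on W f"
  shows "smooth_on W (\<lambda>x. frechet_derivative f (at x) v)"
proof -
  have "iter_deriv (vs @ [v]) f = iter_deriv vs (\<lambda>x. frechet_derivative f (at x) v)" for vs
    by (induction vs) simp_all
  with assms show ?thesis
    unfolding smooth_on_def by metis
qed

lemma smooth_on_continuous_on: "smooth_on W f \<Longrightarrow> continuous_on W f"
  by (meson continuous_at_imp_continuous_on differentiable_imp_continuous_within
      smooth_on_differentiable)

lemma dzbar_of_real:
  assumes "r differentiable (at p)"
  shows "dzbar k (\<lambda>z. complex_of_real (r z)) p
    = Complex (frechet_derivative r (at p) (axis k 1) / 2)
        (frechet_derivative r (at p) (axis k \<i>) / 2)"
proof -
  have "((\<lambda>z. complex_of_real (r z)) has_derivative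
      (\<lambda>v. complex_of_real (frechet_derivative r (at p) v))) (at p)"
    using assms by (intro has_derivative_of_real) (simp add: frechet_derivative_works)
  then have "frechet_derivative (\<lambda>z. complex_of_real (r z)) (at p)
      = (\<lambda>v. complex_of_real (frechet_derivative r (at p) v))"
    by (rule frechet_derivative_at [symmetric])
  then show ?thesis
    by (simp add: dzbar_def complex_eq_iff)
qed

text \<open>For real-valued \<open>r\<close>, \<open>dbar_vec r p\<close> is half the real gradient,
  whence the factor 2.\<close>

lemma inner_dbar_vec:
  assumes "r differentiable (at p)"
  shows "frechet_derivative r (at p) v = 2 * (dbar_vec r p \<bullet> v)"
proof -
  define D where "D = frechet_derivative r (at p)"
  interpret D: linear D
    using assms unfolding D_def by (rule linear_frechet_derivative)
  have v: "v = Re (v $ 1) *\<^sub>R axis 1 1 + Im (v $ 1) *\<^sub>R axis 1 \<i>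
      + Re (v $ 2) *\<^sub>R axis 2 1 + Im (v $ 2) *\<^sub>R axis 2 \<i>"
    by (auto simp: vec_eq_iff forall_2 axis_def complex_eq_iff)
  have "D v = Re (v $ 1) * D (axis 1 1) + Im (v $ 1) * D (axis 1 \<i>)
      + Re (v $ 2) * D (axis 2 1) + Im (v $ 2) * D (axis 2 \<i>)"
    by (subst v) (simp add: D.add D.scaleR)
  then show ?thesis
    by (simp add: D_def [symmetric] dbar_vec_def dzbar_of_real [OF assms] inner_vec_def sum_2
        inner_complex_def algebra_simps)
qed

lemma dbar_vec_continuous_on:
  assumes "smooth_on W r"
  shows "continuous_on W (dbar_vec r)"
proof -
  have "continuous_on W (\<lambda>p. dbar_vec r p $ k)" for k
  proof -
    have "continuous_on W (\<lambda>p. Complex (frechet_derivative r (at p) (axis k 1) / 2)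
        (frechet_derivative r (at p) (axis k \<i>) / 2))"
      by (intro continuous_intros smooth_on_continuous_on [OF smooth_on_frechet [OF assms]]) auto
    then show ?thesis
      by (rule continuous_on_eq)
        (simp add: dbar_vec_def dzbar_of_real smooth_on_differentiable [OF assms])
  qed
  then have "continuous_on W (\<lambda>p. \<chi> k. dbar_vec r p $ k)"
    by (rule continuous_on_vec_lambda)
  then show ?thesis
    by simp
qed

text \<open>Two mean value estimates on the segment from \<open>p\<close> to \<open>q\<close>:
  bounded second derivatives make the first derivatives Lipschitz, and this bounds the error of
  linearization. Uniformity in \<open>p\<close> comes from bounding second derivatives on a compact
  tube around \<open>T\<close>.\<close>

lemma smooth_on_uniform_taylor:
  fixes r :: "'a::euclidean_space \<Rightarrow> real"
  assumes "smooth_on W r" "open W" "compact T" "T \<subseteq> W"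
  obtains \<rho> M where "0 < \<rho>" "0 < M" "(\<Union>p\<in>T. cball p \<rho>) \<subseteq> W"
    "\<And>p q. p \<in> T \<Longrightarrow> dist p q \<le> \<rho> \<Longrightarrow>
      \<bar>r q - r p - frechet_derivative r (at p) (q - p)\<bar> \<le> M * (norm (q - p))\<^sup>2"
proof -
  define D where "D v f x = frechet_derivative f (at x) v" for v and f :: "'a \<Rightarrow> real" and x
  have smooth_D: "smooth_on W (D v f)" if "smooth_on W f" for v f
    unfolding D_def using smooth_on_frechet [OF that] .
  have has_der: "(f has_derivative (\<lambda>v. D v f x)) (at x)" if "smooth_on W f" "x \<in> W" for f x
    using smooth_on_differentiable [OF that] by (simp add: D_def frechet_derivative_works)
  obtain \<rho> where \<rho>: "0 < \<rho>" "(\<Union>p\<in>T. cball p \<rho>) \<subseteq> W"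
    using compact_subset_open_imp_cball_epsilon_subset [OF \<open>compact T\<close> \<open>open W\<close> \<open>T \<subseteq> W\<close>] .
  define Q where "Q = (\<Union>p\<in>T. cball p \<rho>)"
  \<comment> \<open>As the Minkowski sum of \<open>T\<close> and a closed ball, the tube is
    compact.\<close>
  have "Q = {x + y |x y. x \<in> T \<and> y \<in> cball 0 \<rho>}"
  proof (intro set_eqI iffI)
    fix x assume "x \<in> Q"
    then obtain p where "p \<in> T" "x - p \<in> cball 0 \<rho>"
      by (auto simp: Q_def dist_norm norm_minus_commute)
    then show "x \<in> {x + y |x y. x \<in> T \<and> y \<in> cball 0 \<rho>}"
      by (intro CollectI exI [of _ p] exI [of _ "x - p"]) simp
  next
    fix x assume "x \<in> {x + y |x y. x \<in> T \<and> y \<in> cball 0 \<rho>}"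
    then obtain p y where "x = p + y" "p \<in> T" "norm y \<le> \<rho>"
      by auto
    then show "x \<in> Q"
      by (auto simp: Q_def dist_norm intro!: bexI [of _ p])
  qed
  then have "compact Q"
    using compact_sums [OF \<open>compact T\<close> compact_cball [of 0 \<rho>]] by simp
  have "\<exists>B. \<forall>x\<in>Q. \<bar>D c (D b r) x\<bar> \<le> B" for b c
  proof -
    have "continuous_on Q (D c (D b r))"
      using smooth_on_continuous_on [OF smooth_D [OF smooth_D [OF assms(1)]]] \<rho>(2)
      by (auto simp: Q_def intro: continuous_on_subset)
    then have "bounded (D c (D b r) ` Q)"
      using \<open>compact Q\<close> compact_continuous_image compact_imp_bounded by blast
    then show ?thesis
      by (auto simp: bounded_iff)
  qed
  then have "\<forall>b c. \<exists>B. \<forall>x\<in>Q. \<bar>D c (D b r) x\<bar> \<le> B"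
    by blast
  then obtain B where B: "\<And>b c x. x \<in> Q \<Longrightarrow> \<bar>D c (D b r) x\<bar> \<le> B b c"
    unfolding choice_iff by blast
  \<comment> \<open>Operator norms are bounded by sums over basis directions; the added 1 makes
    \<open>M\<close> positive.\<close>
  define M where "M = 1 + (\<Sum>b\<in>Basis. \<Sum>c\<in>Basis. \<bar>B b c\<bar>)"
  have "0 < M"
    by (simp add: M_def add_pos_nonneg sum_nonneg)
  moreover have "\<bar>r q - r p - frechet_derivative r (at p) (q - p)\<bar> \<le> M * (norm (q - p))\<^sup>2"
    if p: "p \<in> T" and q: "dist p q \<le> \<rho>" for p q
  proof -
    have sub: "closed_segment p q \<subseteq> cball p \<rho>"
      using q \<rho>(1) by (intro closed_segment_subset) auto
    then have subQ: "closed_segment p q \<subseteq> Q" and subW: "closed_segment p q \<subseteq> W"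
      using p \<rho>(2) by (auto simp: Q_def)
    have lip: "\<bar>D b r x - D b r p\<bar> \<le> (\<Sum>c\<in>Basis. \<bar>B b c\<bar>) * norm (q - p)"
      if x: "x \<in> closed_segment p q" for b x
    proof -
      have "norm (D b r x - D b r p) \<le> (\<Sum>c\<in>Basis. \<bar>B b c\<bar>) * norm (x - p)"
      proof (rule differentiable_bound [of "closed_segment p q" "D b r" "\<lambda>x v. D v (D b r) x"])
        fix y assume y: "y \<in> closed_segment p q"
        show "(D b r has_derivative (\<lambda>v. D v (D b r) y)) (at y within closed_segment p q)"
          using has_der [OF smooth_D [OF assms(1)]] y subW
          by (blast intro: has_derivative_at_withinI)
        have "bounded_linear (\<lambda>v. D v (D b r) y)"
          using has_der [OF smooth_D [OF assms(1)]] y subW has_derivative_bounded_linear by blast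
        then have "onorm (\<lambda>v. D v (D b r) y) \<le> (\<Sum>c\<in>Basis. norm (D c (D b r) y))"
          by (rule onorm_componentwise)
        also have "\<dots> \<le> (\<Sum>c\<in>Basis. \<bar>B b c\<bar>)"
          using B y subQ by (intro sum_mono) (smt (verit) real_norm_def subsetD)
        finally show "onorm (\<lambda>v. D v (D b r) y) \<le> (\<Sum>c\<in>Basis. \<bar>B b c\<bar>)" .
      qed (use x in auto)
      also have "\<dots> \<le> (\<Sum>c\<in>Basis. \<bar>B b c\<bar>) * norm (q - p)"
        using segment_bound(1) [OF x] by (intro mult_left_mono sum_nonneg) auto
      finally show ?thesis by simp
    qed
    have "norm (r q - r p - (\<lambda>v. D v r p) (q - p)) \<le> norm (q - p) * (M * norm (q - p))"
    proof (rule differentiable_bound_linearization [of p q "closed_segment p q" r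
          "\<lambda>x v. D v r x" p])
      fix t :: real assume "t \<in> {0..1}"
      then show "p + t *\<^sub>R (q - p) \<in> closed_segment p q"
        by (auto simp: in_segment algebra_simps)
    next
      fix y assume y: "y \<in> closed_segment p q"
      show "(r has_derivative (\<lambda>v. D v r y)) (at y within closed_segment p q)"
        using has_der [OF assms(1)] y subW by (blast intro: has_derivative_at_withinI)
      have "bounded_linear (\<lambda>v. D v r y - D v r p)"
        using has_derivative_bounded_linear [OF has_der [OF assms(1)]] y subW
        by (intro bounded_linear_sub) auto
      then have "onorm (\<lambda>v. D v r y - D v r p) \<le> (\<Sum>b\<in>Basis. norm (D b r y - D b r p))"
        by (rule onorm_componentwise)
      also have "\<dots> \<le> (\<Sum>b\<in>Basis. (\<Sum>c\<in>Basis. \<bar>B b c\<bar>) * norm (q - p))"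
        using lip [OF y] by (intro sum_mono) simp
      also have "\<dots> \<le> M * norm (q - p)"
        by (simp add: M_def sum_distrib_right [symmetric] distrib_right)
      finally show "onorm ((\<lambda>v. D v r y) - (\<lambda>v. D v r p)) \<le> M * norm (q - p)"
        by (simp add: fun_diff_def)
    qed auto
    then show ?thesis
      by (simp add: D_def power2_eq_square algebra_simps)
  qed
  ultimately show thesis
    using that \<rho> by blast
qed

section \<open>Distance to the boundary\<close>

text \<open>The ball is connected, so leaving \<open>\<Omega>\<close> would force it to meet the
  frontier at distance less than its radius.\<close>

lemma ball_bdist_subset:
  assumes "z \<in> \<Omega>"
  shows "ball z (bdist \<Omega> z) \<subseteq> \<Omega>"
proof (rule ccontr)
  assume "\<not> ball z (bdist \<Omega> z) \<subseteq> \<Omega>"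
  then obtain w where w: "w \<in> ball z (bdist \<Omega> z)" "w \<notin> \<Omega>"
    by blast
  then have "0 < bdist \<Omega> z"
    by (metis ball_eq_empty empty_iff not_le)
  then have "ball z (bdist \<Omega> z) \<inter> \<Omega> \<noteq> {}"
    using assms by (metis IntI centre_in_ball empty_iff)
  then have "ball z (bdist \<Omega> z) \<inter> frontier \<Omega> \<noteq> {}"
    by (rule connected_Int_frontier [OF connected_ball]) (use w in blast)
  then obtain q where "q \<in> ball z (bdist \<Omega> z)" "q \<in> frontier \<Omega>"
    by blast
  then show False
    using infdist_le [of q "frontier \<Omega>" z] by (simp add: bdist_def)
qed

text \<open>Where the nearest point is unique, the distance is squeezed between two expressions with
  the same linear part: the distance to \<open>p\<close> from above and, from below, tangent
  estimates at the nearest points of \<open>w\<close>, which converge to \<open>p\<close>.\<close>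

lemma has_derivative_infdist:
  fixes z :: "'a::euclidean_space"
  assumes "closed S" "S \<noteq> {}" "z \<notin> S" "p \<in> S"
    and nearest: "\<And>q. q \<in> S \<Longrightarrow> dist z q = infdist z S \<longleftrightarrow> q = p"
  shows "((\<lambda>w. infdist w S) has_derivative (\<lambda>v. ((z - p) /\<^sub>R norm (z - p)) \<bullet> v)) (at z)"
proof -
  define d where "d = infdist z S"
  have d: "0 < d" "norm (z - p) = d"
    using assms in_closed_iff_infdist_zero [of S z] infdist_nonneg [of z S] nearest [of p]
    by (auto simp: d_def dist_norm)
  define nst where "nst w = (SOME q. q \<in> S \<and> dist w q = infdist w S)" for w
  have nst: "nst w \<in> S" "dist w (nst w) = infdist w S" for w
    using infdist_attains_inf [OF \<open>closed S\<close> \<open>S \<noteq> {}\<close>, of w]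
    unfolding nst_def by (metis (mono_tags, lifting) someI_ex)+
  have lim: "(nst \<longlongrightarrow> p) (at z)"
  proof (rule tendstoI)
    fix e :: real assume "0 < e"
    \<comment> \<open>Points of \<open>S\<close> away from \<open>p\<close> are farther from
      \<open>z\<close> by a gap \<open>\<eta>\<close>: a minimiser over the closed set
      \<open>T\<close> exists and differs from \<open>p\<close>.\<close>
    define T where "T = S - ball p e"
    have "\<exists>\<eta>>0. \<forall>q\<in>T. d + \<eta> \<le> dist z q"
    proof (cases "T = {}")
      case False
      have "closed T"
        unfolding T_def using \<open>closed S\<close> by (intro closed_Diff) auto
      then obtain q where q: "q \<in> T" "\<And>q'. q' \<in> T \<Longrightarrow> dist z q \<le> dist z q'"
        using distance_attains_inf [OF \<open>closed T\<close> False, of z] by blast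
      have "q \<in> S" "q \<noteq> p"
        using q(1) \<open>0 < e\<close> by (auto simp: T_def)
      then have "d < dist z q"
        using nearest [of q] infdist_le [of q S z] by (simp add: d_def less_le)
      then show ?thesis
        using q(2) by (intro exI [of _ "dist z q - d"]) auto
    qed (auto intro: exI [of _ 1])
    then obtain \<eta> where \<eta>: "0 < \<eta>" "\<And>q. q \<in> T \<Longrightarrow> d + \<eta> \<le> dist z q"
      by blast
    \<comment> \<open>The distance from \<open>z\<close> to \<open>nst w\<close> exceeds
      \<open>d\<close> by at most twice \<open>dist w z\<close>, hence by less than
      \<open>\<eta>\<close>.\<close>
    have "dist (nst w) p < e" if w: "dist w z < min 1 (\<eta> / 3)" for w
    proof (rule ccontr)
      assume far: "\<not> dist (nst w) p < e"
      have "infdist w S \<le> d + dist w z"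
        using infdist_triangle [of w S z] by (simp add: d_def)
      moreover have "dist z (nst w) \<le> dist w z + dist w (nst w)"
        by (metis dist_commute dist_triangle)
      ultimately have le: "dist z (nst w) \<le> d + 2 * dist w z"
        using nst(2) [of w] by simp
      then have "nst w \<in> T"
        using far w nst(1) by (auto simp: T_def dist_commute)
      then show False
        using \<eta> le w by fastforce
    qed
    then show "\<forall>\<^sub>F w in at z. dist (nst w) p < e"
      using \<eta>(1) by (auto simp: eventually_at intro!: exI [of _ "min 1 (\<eta> / 3)"])
  qed
  define n where "n q = (z - q) /\<^sub>R norm (z - q)" for q
  \<comment> \<open>Tangent inequality at \<open>z\<close> for the convex function sending
    \<open>w\<close> to \<open>norm (w - q)\<close>, whose gradient there is
    \<open>n q\<close>.\<close>
  have n_le: "norm (z - q) + n q \<bullet> (w - z) \<le> norm (w - q)" if "z \<noteq> q" for w q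
  proof -
    have "(z - q) \<bullet> (w - q) \<le> norm (z - q) * norm (w - q)"
      by (rule norm_cauchy_schwarz)
    moreover have "(z - q) \<bullet> (w - q) = (norm (z - q))\<^sup>2 + (z - q) \<bullet> (w - z)"
      by (simp add: power2_norm_eq_inner inner_diff_right inner_diff_left algebra_simps)
    ultimately have "norm (z - q) * (norm (z - q) + n q \<bullet> (w - z)) \<le> norm (z - q) * norm (w - q)"
      using that by (simp add: n_def power2_eq_square algebra_simps)
    then show ?thesis
      using that by simp
  qed
  have "((\<lambda>w. (infdist w S - infdist z S - n p \<bullet> (w - z)) /\<^sub>R norm (w - z)) \<longlongrightarrow> 0) (at z)"
  proof (rule tendsto_sandwich [where f = "\<lambda>w. - norm (n (nst w) - n p)"])
    define N where "N w = norm (w - p) - norm (z - p) - n p \<bullet> (w - z)" for w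
    have low: "- norm (n (nst w) - n p) \<le> (infdist w S - infdist z S - n p \<bullet> (w - z)) /\<^sub>R norm (w - z)"
      if "w \<noteq> z" for w
    proof -
      have "z \<noteq> nst w"
        using nst(1) \<open>z \<notin> S\<close> by metis
      then have "norm (z - nst w) + n (nst w) \<bullet> (w - z) \<le> infdist w S"
        using n_le [of "nst w" w] nst(2) [of w] by (simp add: dist_norm)
      moreover have "infdist z S \<le> norm (z - nst w)"
        using infdist_le [OF nst(1)] by (simp add: dist_norm)
      moreover have "- (norm (n (nst w) - n p) * norm (w - z)) \<le> (n (nst w) - n p) \<bullet> (w - z)"
        using Cauchy_Schwarz_ineq2 [of "n (nst w) - n p" "w - z"] by linarith
      ultimately show ?thesis
        using that by (simp add: field_simps inner_diff_left)
    qed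
    show "\<forall>\<^sub>F w in at z. - norm (n (nst w) - n p)
        \<le> (infdist w S - infdist z S - n p \<bullet> (w - z)) /\<^sub>R norm (w - z)"
      using low by (auto simp: eventually_at intro: exI [of _ 1])
    show "\<forall>\<^sub>F w in at z. (infdist w S - infdist z S - n p \<bullet> (w - z)) /\<^sub>R norm (w - z)
        \<le> N w /\<^sub>R norm (w - z)"
    proof (rule always_eventually, rule allI)
      fix w
      show "(infdist w S - infdist z S - n p \<bullet> (w - z)) /\<^sub>R norm (w - z) \<le> N w /\<^sub>R norm (w - z)"
        using infdist_le [OF \<open>p \<in> S\<close>, of w] d
        by (intro scaleR_left_mono) (auto simp: N_def d_def dist_norm)
    qed
    have "(n \<longlongrightarrow> n p) (at p)"
      using d unfolding n_def by (intro tendsto_intros) auto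
    then have "((\<lambda>w. n (nst w)) \<longlongrightarrow> n p) (at z)"
      by (rule tendsto_compose [OF _ lim])
    then have "((\<lambda>w. - norm (n (nst w) - n p)) \<longlongrightarrow> - norm (n p - n p)) (at z)"
      by (intro tendsto_intros)
    then show "((\<lambda>w. - norm (n (nst w) - n p)) \<longlongrightarrow> 0) (at z)"
      by simp
    have "((\<lambda>w. norm (w - p)) has_derivative (\<lambda>v. v \<bullet> sgn (z - p))) (at z)"
      by (rule has_derivative_compose [OF _ has_derivative_norm, of "\<lambda>w. w - p" "\<lambda>v. v", simplified])
        (use d in \<open>auto intro!: derivative_eq_intros\<close>)
    then have "((\<lambda>w. (norm (w - p) - norm (z - p) - (w - z) \<bullet> sgn (z - p)) /\<^sub>R norm (w - z)) \<longlongrightarrow> 0) (at z)"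
      by (simp add: has_derivative_at_within)
    then show "((\<lambda>w. N w /\<^sub>R norm (w - z)) \<longlongrightarrow> 0) (at z)"
      by (simp add: N_def n_def sgn_div_norm inner_commute)
  qed
  then show ?thesis
    unfolding has_derivative_at_within n_def [symmetric]
    using bounded_linear_inner_right [of "n p"] by simp
qed

text \<open>On vectors \<open>sgn\<close> normalises. The gradient of \<open>r\<close> points out of
  \<open>\<Omega>\<close> because \<open>r\<close> is negative inside, hence the minus sign.\<close>

definition inward_normal :: "(complex^2 \<Rightarrow> real) \<Rightarrow> complex^2 \<Rightarrow> complex^2" where
  "inward_normal r p = - sgn (dbar_vec r p)"

section \<open>Boundary normals and interior balls\<close>

context
  fixes \<Omega> :: "(complex^2) set" and r :: "complex^2 \<Rightarrow> real"
  assumes dom: "smoothly_bounded_domain \<Omega> r"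
begin

lemma open_domain: "open \<Omega>" and connected_domain: "connected \<Omega>"
  using dom by (auto simp: smoothly_bounded_domain_def)

lemma frontier_compact: "compact (frontier \<Omega>)"
  and frontier_nonempty: "frontier \<Omega> \<noteq> {}"
proof -
  have "bounded \<Omega>" "\<Omega> \<noteq> {}"
    using dom by (auto simp: smoothly_bounded_domain_def)
  then show "compact (frontier \<Omega>)" "frontier \<Omega> \<noteq> {}"
    using compact_frontier_bounded frontier_eq_empty [of \<Omega>] not_bounded_UNIV by auto
qed

lemma defining_neighbourhood:
  obtains W where "open W" "frontier \<Omega> \<subseteq> W" "smooth_on W r"
    "\<Omega> \<inter> W = {z \<in> W. r z < 0}" "\<And>p. p \<in> frontier \<Omega> \<Longrightarrow> r p = 0"
  using dom unfolding smoothly_bounded_domain_def defining_function_def by blast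

lemma dbar_vec_nonzero: "p \<in> frontier \<Omega> \<Longrightarrow> dbar_vec r p \<noteq> 0"
  using dom unfolding smoothly_bounded_domain_def defining_function_def by blast

lemma norm_inward_normal: "p \<in> frontier \<Omega> \<Longrightarrow> norm (inward_normal r p) = 1"
  by (simp add: inward_normal_def norm_sgn dbar_vec_nonzero)

lemma inner_dbar_inward_normal:
  "dbar_vec r p \<bullet> v = - norm (dbar_vec r p) * (inward_normal r p \<bullet> v)"
  by (cases "dbar_vec r p = 0") (simp_all add: inward_normal_def sgn_div_norm)

lemma domain_notin_frontier: "z \<in> \<Omega> \<Longrightarrow> z \<notin> frontier \<Omega>"
  using dom by (auto simp: smoothly_bounded_domain_def frontier_def interior_open)

lemma bdist_pos: "z \<in> \<Omega> \<Longrightarrow> 0 < bdist \<Omega> z"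
  unfolding bdist_def
  using in_closed_iff_infdist_zero [OF frontier_closed frontier_nonempty, of z]
    infdist_nonneg [of z "frontier \<Omega>"] domain_notin_frontier by fastforce

lemma frontier_differentiable: "p \<in> frontier \<Omega> \<Longrightarrow> r differentiable (at p)"
  by (rule defining_neighbourhood) (blast intro: smooth_on_differentiable)

text \<open>The ball around \<open>z\<close> of radius \<open>\<delta>(z)\<close> lies in \<open>\<Omega>\<close>, so \<open>r\<close> restricted to its closure is
  maximal at the nearest point.\<close>

lemma nearest_point_normal:
  assumes z: "z \<in> \<Omega>" and near: "is_nearest \<Omega> z p"
  shows "sgn (z - p) = inward_normal r p"
proof -
  obtain W where W: "open W" "frontier \<Omega> \<subseteq> W" "smooth_on W r" "\<Omega> \<inter> W = {z \<in> W. r z < 0}"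
      "\<And>p. p \<in> frontier \<Omega> \<Longrightarrow> r p = 0"
    using defining_neighbourhood by blast
  have p: "p \<in> frontier \<Omega>" "dist z p = bdist \<Omega> z"
    using near by (auto simp: is_nearest_def)
  define g where "g = dbar_vec r p"
  define u where "u = z - p"
  have u: "0 < norm u" "norm u = bdist \<Omega> z"
    using p bdist_pos [OF z] by (auto simp: u_def dist_norm)
  have g: "g \<noteq> 0"
    using p dbar_vec_nonzero by (simp add: g_def)
  \<comment> \<open>A direction \<open>v\<close> at an acute angle with \<open>u\<close> enters the
    ball around \<open>z\<close>, hence \<open>\<Omega>\<close>, so \<open>r\<close> has nonpositive
    derivative along it at \<open>p\<close>.\<close>
  have neg: "g \<bullet> v \<le> 0" if v: "0 < u \<bullet> v" for v
  proof -
    have "((\<lambda>t. r (p + t *\<^sub>R v)) has_real_derivative 2 * (g \<bullet> v)) (at 0)"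
    proof -
      have "(r has_derivative frechet_derivative r (at p)) (at (p + 0 *\<^sub>R v))"
        using frontier_differentiable [OF p(1)] by (simp add: frechet_derivative_works)
      then have "((\<lambda>t. r (p + t *\<^sub>R v)) has_derivative
          (\<lambda>t. frechet_derivative r (at p) (t *\<^sub>R v))) (at 0)"
        by (rule has_derivative_compose [rotated]) (auto intro!: derivative_eq_intros)
      moreover have "(\<lambda>t. frechet_derivative r (at p) (t *\<^sub>R v)) = (*) (2 * (g \<bullet> v))"
        by (simp add: fun_eq_iff inner_dbar_vec frontier_differentiable [OF p(1)] g_def)
      ultimately show ?thesis
        by (simp add: has_field_derivative_def)
    qed
    moreover have "\<forall>\<^sub>F t in at_right 0. r (p + t *\<^sub>R v) \<le> r p"
    proof -
      have "((\<lambda>t. p + t *\<^sub>R v) \<longlongrightarrow> p + 0 *\<^sub>R v) (at_right 0)"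
        by (intro tendsto_intros)
      then have "\<forall>\<^sub>F t in at_right 0. p + t *\<^sub>R v \<in> W"
        using W(1,2) p(1) by (auto dest: topological_tendstoD)
      moreover have "\<forall>\<^sub>F t in at_right 0. p + t *\<^sub>R v \<in> \<Omega>"
      proof -
        have "((\<lambda>t. 2 * (u \<bullet> v) - t * (norm v)\<^sup>2) \<longlongrightarrow> 2 * (u \<bullet> v) - 0 * (norm v)\<^sup>2) (at_right 0)"
          by (intro tendsto_intros)
        then have "\<forall>\<^sub>F t in at_right 0. 0 < 2 * (u \<bullet> v) - t * (norm v)\<^sup>2"
          by (rule order_tendstoD(1)) (use v in simp)
        then show ?thesis
          using eventually_at_right_less [of "0 :: real"]
        proof eventually_elim
          case (elim t)
          have "(norm (u - t *\<^sub>R v))\<^sup>2 = (norm u)\<^sup>2 - t * (2 * (u \<bullet> v) - t * (norm v)\<^sup>2)"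
            using dot_norm_neg [of u "t *\<^sub>R v"]
            by (simp add: algebra_simps power2_eq_square)
          then have "(norm (u - t *\<^sub>R v))\<^sup>2 < (norm u)\<^sup>2"
            using mult_pos_pos [OF elim(2,1)] by linarith
          then have "norm (u - t *\<^sub>R v) < norm u"
            by (rule power2_less_imp_less) simp
          then have "p + t *\<^sub>R v \<in> ball z (bdist \<Omega> z)"
            by (simp add: dist_norm u(2) [symmetric]) (simp add: u_def algebra_simps)
          then show ?case
            using ball_bdist_subset [OF z] by blast
        qed
      qed
      ultimately show ?thesis
      proof eventually_elim
        case (elim t)
        then have "p + t *\<^sub>R v \<in> \<Omega> \<inter> W"
          by blast
        then show ?case
          unfolding W(4) using W(5) [OF p(1)] by simp
      qed
    qed
    ultimately have "2 * (g \<bullet> v) \<le> 0"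
    proof -
      assume der: "((\<lambda>t. r (p + t *\<^sub>R v)) has_real_derivative 2 * (g \<bullet> v)) (at 0)"
        and ev: "\<forall>\<^sub>F t in at_right 0. r (p + t *\<^sub>R v) \<le> r p"
      have "((\<lambda>t. (r (p + t *\<^sub>R v) - r p) / t) \<longlongrightarrow> 2 * (g \<bullet> v)) (at_right 0)"
        using der by (auto simp: has_field_derivative_iff intro: filterlim_mono at_le)
      moreover have "\<forall>\<^sub>F t in at_right 0. (r (p + t *\<^sub>R v) - r p) / t \<le> 0"
        using ev eventually_at_right_less [of "0 :: real"]
        by eventually_elim (simp add: divide_nonpos_pos)
      ultimately show ?thesis
        by (rule tendsto_upperbound) simp
    qed
    then show ?thesis by simp
  qed
  define c where "c = (g \<bullet> u) / (norm u)\<^sup>2"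
  define w where "w = g - c *\<^sub>R u"
  have uw: "u \<bullet> w = 0"
    using u(1) by (simp add: w_def c_def inner_diff_right inner_commute
        power2_norm_eq_inner [symmetric])
  have gw: "g \<bullet> w = (norm w)\<^sup>2"
    using uw by (simp add: w_def power2_norm_eq_inner inner_diff_left inner_commute)
  have "w = 0"
  proof (rule ccontr)
    assume "w \<noteq> 0"
    have "g \<bullet> (w + \<eta> *\<^sub>R u) \<le> 0" if "0 < \<eta>" for \<eta>
      using neg [of "w + \<eta> *\<^sub>R u"] that uw u(1) by (simp add: inner_add_right)
    then have le: "(norm w)\<^sup>2 + \<eta> * (g \<bullet> u) \<le> 0" if "0 < \<eta>" for \<eta>
      using that by (simp add: inner_add_right gw)
    \<comment> \<open>\<open>w\<close> is only perpendicular to \<open>u\<close>, so it is tilted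
      towards \<open>u\<close>; this \<open>\<eta>\<close> makes the tilt cost at most half of
      \<open>(norm w)\<^sup>2\<close>.\<close>
    define \<eta> where "\<eta> = (norm w)\<^sup>2 / (2 * (\<bar>g \<bullet> u\<bar> + 1))"
    have pos: "0 < (norm w)\<^sup>2" "0 < \<eta>"
      using \<open>w \<noteq> 0\<close> by (auto simp: \<eta>_def intro!: divide_pos_pos)
    have "\<eta> * \<bar>g \<bullet> u\<bar> \<le> (norm w)\<^sup>2 / 2"
      by (simp add: \<eta>_def divide_simps) (simp add: algebra_simps)
    moreover have "- (\<eta> * \<bar>g \<bullet> u\<bar>) \<le> \<eta> * (g \<bullet> u)"
      using pos(2) by (simp add: abs_if)
    ultimately show False
      using le [OF pos(2)] pos(1) by linarith
  qed
  then have gu: "g = c *\<^sub>R u"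
    by (simp add: w_def)
  have "g \<bullet> u \<le> 0"
    using neg [of u] u(1) by simp
  then have "c < 0"
    using gu g u by (metis c_def divide_nonpos_nonneg le_less scaleR_zero_left zero_le_power2)
  then have "sgn g = - sgn u"
    using gu by (simp add: sgn_scaleR)
  then show ?thesis
    by (simp add: inward_normal_def g_def u_def)
qed

text \<open>Let n be the inward normal and g = \<open>dbar_vec r p\<close>. A frontier point q in
  the open ball of radius s about p + s n satisfies |q - p|^2 < 2 s n.(q - p), while the Taylor
  estimate with r(q) = 0 gives 2 |g| n.(q - p) <= M |q - p|^2. Together |g| <= M s, impossible for
  small s.\<close>

lemma uniform_interior_ball:
  obtains s0 where "0 < s0"
    "\<And>p s. p \<in> frontier \<Omega> \<Longrightarrow> 0 < s \<Longrightarrow> s < s0 \<Longrightarrow>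
      p + s *\<^sub>R inward_normal r p \<in> \<Omega> \<and> bdist \<Omega> (p + s *\<^sub>R inward_normal r p) = s"
proof -
  obtain W where W: "open W" "frontier \<Omega> \<subseteq> W" "smooth_on W r" "\<Omega> \<inter> W = {z \<in> W. r z < 0}"
      "\<And>p. p \<in> frontier \<Omega> \<Longrightarrow> r p = 0"
    using defining_neighbourhood by blast
  obtain \<rho> M where \<rho>: "0 < \<rho>" "0 < M" "(\<Union>p\<in>frontier \<Omega>. cball p \<rho>) \<subseteq> W"
    and M: "\<And>p q. p \<in> frontier \<Omega> \<Longrightarrow> dist p q \<le> \<rho> \<Longrightarrow>
      \<bar>r q - r p - frechet_derivative r (at p) (q - p)\<bar> \<le> M * (norm (q - p))\<^sup>2"
    using smooth_on_uniform_taylor [OF W(3,1) frontier_compact W(2)] by blast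
  have "continuous_on (frontier \<Omega>) (\<lambda>p. norm (dbar_vec r p))"
    using dbar_vec_continuous_on [OF W(3)] W(2) by (intro continuous_on_norm) (rule continuous_on_subset)
  then obtain p0 where p0: "p0 \<in> frontier \<Omega>"
      "\<And>p. p \<in> frontier \<Omega> \<Longrightarrow> norm (dbar_vec r p0) \<le> norm (dbar_vec r p)"
    using continuous_attains_inf [OF frontier_compact frontier_nonempty] by blast
  define c where "c = norm (dbar_vec r p0)"
  have c: "0 < c" "\<And>p. p \<in> frontier \<Omega> \<Longrightarrow> c \<le> norm (dbar_vec r p)"
    using p0 dbar_vec_nonzero by (auto simp: c_def)
  \<comment> \<open>\<open>c / M\<close> is the threshold of the contradiction;
    \<open>\<rho> / 2\<close> keeps every competitor \<open>q\<close>, at distance below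
    \<open>2 * s\<close> from \<open>p\<close>, within range of the Taylor estimate.\<close>
  define s0 where "s0 = min (\<rho> / 2) (c / M)"
  have "0 < s0"
    using \<rho> c by (simp add: s0_def)
  moreover have "p + s *\<^sub>R inward_normal r p \<in> \<Omega> \<and> bdist \<Omega> (p + s *\<^sub>R inward_normal r p) = s"
    if p: "p \<in> frontier \<Omega>" and s: "0 < s" "s < s0" for p s
  proof
    define n where "n = inward_normal r p"
    define z where "z = p + s *\<^sub>R n"
    have nn: "norm n = 1"
      using norm_inward_normal [OF p] by (simp add: n_def)
    have Ms: "M * s < c" "2 * s < \<rho>"
      using s \<rho>(2) by (simp_all add: s0_def field_simps)
    have taylor: "\<bar>r q + 2 * norm (dbar_vec r p) * (n \<bullet> (q - p))\<bar> \<le> M * (norm (q - p))\<^sup>2"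
      if "dist p q \<le> \<rho>" for q
      using M [OF p that] W(5) [OF p] inner_dbar_vec [OF frontier_differentiable [OF p]]
      by (simp add: inner_dbar_inward_normal n_def)
    have dz: "dist p z = s"
      using nn s by (simp add: z_def dist_norm)
    have "r z + 2 * norm (dbar_vec r p) * s \<le> M * s\<^sup>2"
      using taylor [of z] dz Ms(2) s nn by (simp add: z_def power2_norm_eq_inner [symmetric] power_mult_distrib)
    moreover have "M * s\<^sup>2 \<le> c * s"
      using Ms s by (simp add: power2_eq_square)
    moreover have "c * s \<le> norm (dbar_vec r p) * s" "0 < c * s"
      using c p s by auto
    ultimately have "r z < 0"
      by linarith
    moreover have "z \<in> cball p \<rho>"
      using dz Ms s by simp
    then have "z \<in> W"
      using \<rho>(3) p by blast
    ultimately show "p + s *\<^sub>R inward_normal r p \<in> \<Omega>"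
      using W(4) by (auto simp: z_def n_def)
    have "s \<le> dist z q" if q: "q \<in> frontier \<Omega>" for q
    proof (rule ccontr)
      assume "\<not> s \<le> dist z q"
      then have lt: "dist z q < s"
        by simp
      have "dist p q \<le> dist p z + dist z q"
        by (rule dist_triangle)
      then have "dist p q \<le> \<rho>"
        using lt dz Ms by linarith
      then have "2 * norm (dbar_vec r p) * (n \<bullet> (q - p)) \<le> M * (norm (q - p))\<^sup>2"
        using taylor [of q] W(5) [OF q] by simp
      moreover have sq: "(norm (q - p))\<^sup>2 < 2 * s * (n \<bullet> (q - p))"
      proof -
        have "dist z q = norm (s *\<^sub>R n - (q - p))"
          by (simp add: z_def dist_norm algebra_simps)
        then have "(dist z q)\<^sup>2 = (norm (s *\<^sub>R n))\<^sup>2 + (norm (q - p))\<^sup>2 - 2 * (s *\<^sub>R n \<bullet> (q - p))"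
          using dot_norm_neg [of "s *\<^sub>R n" "q - p"] by simp
        then have "(dist z q)\<^sup>2 = (norm (q - p))\<^sup>2 - 2 * s * (n \<bullet> (q - p)) + s\<^sup>2"
          using nn by simp
        moreover have "(dist z q)\<^sup>2 < s\<^sup>2"
          using lt by (simp add: power_strict_mono)
        ultimately show ?thesis by linarith
      qed
      moreover have "0 < n \<bullet> (q - p)"
        using sq s by (smt (verit) mult_nonneg_nonpos zero_le_power2)
      ultimately have "2 * norm (dbar_vec r p) * (n \<bullet> (q - p)) \<le> M * (2 * s * (n \<bullet> (q - p)))"
        using \<rho>(2) by (smt (verit) mult_left_mono)
      then have "norm (dbar_vec r p) * (2 * (n \<bullet> (q - p))) \<le> (M * s) * (2 * (n \<bullet> (q - p)))"
        by (simp add: algebra_simps)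
      then have "norm (dbar_vec r p) \<le> M * s"
        using \<open>0 < n \<bullet> (q - p)\<close> by simp
      then show False
        using c(2) [OF p] Ms by linarith
    qed
    then have "s \<le> bdist \<Omega> z"
      unfolding bdist_def infdist_notempty [OF frontier_nonempty]
      by (intro cINF_greatest frontier_nonempty)
    moreover have "bdist \<Omega> z \<le> s"
      using infdist_le [OF p, of z] dz by (simp add: bdist_def dist_commute)
    ultimately show "bdist \<Omega> (p + s *\<^sub>R inward_normal r p) = s"
      by (simp add: z_def n_def)
  qed
  ultimately show thesis
    by (rule that)
qed

lemma inward_normal_uniformly_continuous: "uniformly_continuous_on (frontier \<Omega>) (inward_normal r)"
proof -
  obtain W where W: "open W" "frontier \<Omega> \<subseteq> W" "smooth_on W r" "\<Omega> \<inter> W = {z \<in> W. r z < 0}"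
      "\<And>p. p \<in> frontier \<Omega> \<Longrightarrow> r p = 0"
    using defining_neighbourhood by blast
  then have "continuous_on (frontier \<Omega>) (dbar_vec r)"
    using dbar_vec_continuous_on [OF W(3)] continuous_on_subset W(2) by blast
  then have "continuous_on (frontier \<Omega>) (inward_normal r)"
    unfolding inward_normal_def [abs_def] sgn_div_norm
    by (intro continuous_intros) (auto simp: dbar_vec_nonzero)
  then show ?thesis
    using compact_uniformly_continuous frontier_compact by blast
qed

section \<open>Points with a unique nearest frontier point\<close>

context
  fixes z :: "complex^2"
  assumes z: "z \<in> \<Omega>" and unique: "\<exists>!p. is_nearest \<Omega> z p"
begin

lemma proj_nearest: "is_nearest \<Omega> z (proj \<Omega> z)"
  unfolding proj_def using unique by (rule theI')

lemma proj_frontier: "proj \<Omega> z \<in> frontier \<Omega>"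
  using proj_nearest by (simp add: is_nearest_def)

lemma proj_eq: "is_nearest \<Omega> z p \<Longrightarrow> proj \<Omega> z = p"
  using unique proj_nearest by blast

lemma bdist_has_derivative:
  "(bdist \<Omega> has_derivative (\<lambda>v. inward_normal r (proj \<Omega> z) \<bullet> v)) (at z)"
proof -
  have "dist z q = infdist z (frontier \<Omega>) \<longleftrightarrow> q = proj \<Omega> z" if "q \<in> frontier \<Omega>" for q
    using that proj_eq [of q] proj_nearest by (auto simp: is_nearest_def bdist_def)
  then have "((\<lambda>w. infdist w (frontier \<Omega>)) has_derivative
      (\<lambda>v. ((z - proj \<Omega> z) /\<^sub>R norm (z - proj \<Omega> z)) \<bullet> v)) (at z)"
    using frontier_nonempty domain_notin_frontier [OF z] proj_frontier
    by (intro has_derivative_infdist) auto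
  then show ?thesis
    by (simp only: bdist_def [abs_def] nearest_point_normal [OF z proj_nearest, symmetric] sgn_div_norm)
qed

lemma abs_inner_inward_normal_le:
  "\<bar>inward_normal r (proj \<Omega> z) \<bullet> X\<bar> \<le> norm (N_part \<Omega> r z X)"
proof -
  have "dbar_vec r (proj \<Omega> z) \<bullet> X = dbar_vec r (proj \<Omega> z) \<bullet> N_part \<Omega> r z X"
    by (rule inner_dbar_eq_N_part) (simp_all add: dbar_vec_nonzero proj_frontier)
  then have "inward_normal r (proj \<Omega> z) \<bullet> X = inward_normal r (proj \<Omega> z) \<bullet> N_part \<Omega> r z X"
    by (simp add: inward_normal_def sgn_div_norm)
  then show ?thesis
    using Cauchy_Schwarz_ineq2 [of "inward_normal r (proj \<Omega> z)" "N_part \<Omega> r z X"]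
    by (simp add: norm_inward_normal [OF proj_frontier])
qed

lemma H_part_inward_normal: "H_part \<Omega> r z (a *\<^sub>R inward_normal r (proj \<Omega> z)) = 0"
proof -
  have "a *\<^sub>R inward_normal r (proj \<Omega> z)
      = (- a / norm (dbar_vec r (proj \<Omega> z))) *\<^sub>R dbar_vec r (proj \<Omega> z)"
    by (simp add: inward_normal_def sgn_div_norm divide_inverse)
  then show ?thesis
    by (simp only: H_part_dbar [OF refl dbar_vec_nonzero [OF proj_frontier]])
qed

lemmas norm_parts_bounds =
  norm_H_part_le [OF refl dbar_vec_nonzero [OF proj_frontier]]
  norm_N_part_le [OF refl dbar_vec_nonzero [OF proj_frontier]]
  norm_le_parts [OF refl dbar_vec_nonzero [OF proj_frontier]]

end

end

section \<open>Piecewise smooth curves\<close>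

definition C1_segment :: "(real \<Rightarrow> 'a::real_normed_vector) \<Rightarrow> real \<Rightarrow> real \<Rightarrow> bool" where
  "C1_segment \<gamma> a b \<longleftrightarrow>
     (\<exists>\<gamma>'. continuous_on {a..b} \<gamma>' \<and>
       (\<forall>t\<in>{a..b}. (\<gamma> has_vector_derivative \<gamma>' t) (at t within {a..b})))"

text \<open>The curves of \<open>piecewise_C1_curve\<close> on arbitrary intervals and without a
  list of breakpoints: pieces are appended on the right, which gives the induction used below, with
  the degenerate interval as base case.\<close>

inductive piecewise_C1 :: "(real \<Rightarrow> 'a::real_normed_vector) \<Rightarrow> real \<Rightarrow> real \<Rightarrow> bool"
  for \<gamma> where
  refl: "piecewise_C1 \<gamma> a a"
| step: "piecewise_C1 \<gamma> a b \<Longrightarrow> b < c \<Longrightarrow> C1_segment \<gamma> b c \<Longrightarrow> piecewise_C1 \<gamma> a c"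

lemma piecewise_C1_le: "piecewise_C1 \<gamma> a b \<Longrightarrow> a \<le> b"
  by (induction rule: piecewise_C1.induct) auto

lemma piecewise_C1_trans: "piecewise_C1 \<gamma> b c \<Longrightarrow> piecewise_C1 \<gamma> a b \<Longrightarrow> piecewise_C1 \<gamma> a c"
  by (induction rule: piecewise_C1.induct) (auto intro: piecewise_C1.step)

lemma C1_segment_cong:
  assumes "C1_segment \<gamma> a b" "\<And>t. t \<in> {a..b} \<Longrightarrow> \<eta> t = \<gamma> t"
  shows "C1_segment \<eta> a b"
proof -
  obtain \<gamma>' where g: "continuous_on {a..b} \<gamma>'"
    "\<And>t. t \<in> {a..b} \<Longrightarrow> (\<gamma> has_vector_derivative \<gamma>' t) (at t within {a..b})"
    using assms(1) by (auto simp: C1_segment_def)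
  have "(\<eta> has_vector_derivative \<gamma>' t) (at t within {a..b})" if "t \<in> {a..b}" for t
    by (rule has_vector_derivative_transform [OF that _ g(2) [OF that]]) (use assms(2) in auto)
  with g(1) show ?thesis
    by (auto simp: C1_segment_def)
qed

lemma piecewise_C1_cong:
  "piecewise_C1 \<gamma> a b \<Longrightarrow> (\<And>t. t \<in> {a..b} \<Longrightarrow> \<eta> t = \<gamma> t) \<Longrightarrow> piecewise_C1 \<eta> a b"
proof (induction rule: piecewise_C1.induct)
  case (step a b c)
  then show ?case
    using piecewise_C1_le [OF step(1)]
    by (intro piecewise_C1.step [of _ a b c] C1_segment_cong [OF step(3)]) auto
qed (rule piecewise_C1.refl)

lemma C1_segment_affine:
  assumes "C1_segment \<gamma> a b" "0 < k"
  shows "C1_segment (\<lambda>t. \<gamma> (k * t + d)) ((a - d) / k) ((b - d) / k)"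
proof -
  obtain \<gamma>' where g: "continuous_on {a..b} \<gamma>'"
    "\<And>t. t \<in> {a..b} \<Longrightarrow> (\<gamma> has_vector_derivative \<gamma>' t) (at t within {a..b})"
    using assms(1) by (auto simp: C1_segment_def)
  let ?I = "{(a - d) / k..(b - d) / k}"
  have img: "(\<lambda>t. k * t + d) ` ?I \<subseteq> {a..b}"
    using \<open>0 < k\<close> by (auto simp: field_simps)
  have "continuous_on ?I (\<lambda>t. k *\<^sub>R \<gamma>' (k * t + d))"
    by (intro continuous_intros continuous_on_compose2 [OF g(1) _ img])
  moreover have "((\<lambda>t. \<gamma> (k * t + d)) has_vector_derivative k *\<^sub>R \<gamma>' (k * t + d)) (at t within ?I)"
    if "t \<in> ?I" for t
  proof -
    have "((\<lambda>t. k * t + d) has_vector_derivative k) (at t within ?I)"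
      unfolding has_real_derivative_iff_has_vector_derivative [symmetric]
      by (auto intro!: derivative_eq_intros)
    moreover have "(\<gamma> has_vector_derivative \<gamma>' (k * t + d)) (at (k * t + d) within (\<lambda>t. k * t + d) ` ?I)"
      using img that by (intro has_vector_derivative_within_subset [OF g(2) img]) blast
    ultimately have "(\<gamma> \<circ> (\<lambda>t. k * t + d) has_vector_derivative k *\<^sub>R \<gamma>' (k * t + d)) (at t within ?I)"
      by (rule vector_diff_chain_within)
    then show ?thesis
      by (simp only: o_def)
  qed
  ultimately show ?thesis
    unfolding C1_segment_def
    by (intro exI [of _ "\<lambda>t. k *\<^sub>R \<gamma>' (k * t + d)"] conjI ballI)
qed

lemma piecewise_C1_affine:
  "piecewise_C1 \<gamma> a b \<Longrightarrow> 0 < k \<Longrightarrow> piecewise_C1 (\<lambda>t. \<gamma> (k * t + d)) ((a - d) / k) ((b - d) / k)"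
proof (induction rule: piecewise_C1.induct)
  case (step a b c)
  then show ?case
    by (auto intro!: piecewise_C1.step [OF step.IH] C1_segment_affine divide_strict_right_mono)
qed (rule piecewise_C1.refl)

lemma piecewise_C1_curve_iff: "piecewise_C1_curve \<gamma> \<longleftrightarrow> piecewise_C1 \<gamma> 0 1"
proof
  assume "piecewise_C1_curve \<gamma>"
  then obtain ts where ts: "ts \<noteq> []" "sorted_wrt (<) ts" "hd ts = 0" "last ts = 1"
    and seg: "\<And>i. Suc i < length ts \<Longrightarrow> C1_segment \<gamma> (ts ! i) (ts ! Suc i)"
    unfolding piecewise_C1_curve_def C1_segment_def [symmetric] by blast
  have "piecewise_C1 \<gamma> (ts ! 0) (ts ! n)" if "n < length ts" for n
    using that
  proof (induction n)
    case (Suc n)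
    then show ?case
      using seg [of n] sorted_wrt_nth_less [OF ts(2), of n "Suc n"]
      by (auto intro: piecewise_C1.step [OF Suc.IH])
  qed (rule piecewise_C1.refl)
  from this [of "length ts - 1"] show "piecewise_C1 \<gamma> 0 1"
    using ts by (simp add: hd_conv_nth last_conv_nth)
next
  \<comment> \<open>The bound on \<open>set ts\<close> strengthens the induction: it lets a new last
    breakpoint be appended in strictly increasing order.\<close>
  have "\<exists>ts. ts \<noteq> [] \<and> sorted_wrt (<) ts \<and> hd ts = a \<and> last ts = b \<and> (\<forall>t\<in>set ts. t \<le> b) \<and>
      (\<forall>i. Suc i < length ts \<longrightarrow> C1_segment \<gamma> (ts ! i) (ts ! Suc i))"
    if "piecewise_C1 \<gamma> a b" for a b
    using that
  proof (induction rule: piecewise_C1.induct)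
    case (refl a)
    show ?case by (rule exI [of _ "[a]"]) simp
  next
    case (step a b c)
    then obtain ts where ts: "ts \<noteq> []" "sorted_wrt (<) ts" "hd ts = a" "last ts = b"
      "\<forall>t\<in>set ts. t \<le> b" "\<And>i. Suc i < length ts \<Longrightarrow> C1_segment \<gamma> (ts ! i) (ts ! Suc i)"
      by blast
    have "C1_segment \<gamma> ((ts @ [c]) ! i) ((ts @ [c]) ! Suc i)" if "Suc i < length (ts @ [c])" for i
    proof (cases "Suc i < length ts")
      case False
      then have "i = length ts - 1" "Suc i = length ts"
        using that ts(1) by auto
      then show ?thesis
        using step(3) ts(1,4) by (auto simp: nth_append last_conv_nth)
    qed (use ts(6) in \<open>simp add: nth_append\<close>)
    then show ?case
      using ts step(2) by (intro exI [of _ "ts @ [c]"]) (auto simp: sorted_wrt_append)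
  qed
  moreover assume "piecewise_C1 \<gamma> 0 1"
  ultimately show "piecewise_C1_curve \<gamma>"
    unfolding piecewise_C1_curve_def C1_segment_def [symmetric] by blast
qed

text \<open>\<open>S\<close> collects the end points and breakpoints, where the two-sided derivative
  may fail. The bound \<open>B\<close> exists because each piece is \<open>C\<^sup>1\<close> up to
  its end points.\<close>

lemma piecewise_C1_regularity:
  assumes "piecewise_C1 \<gamma> a b"
  obtains S B where "finite S" "a \<in> S" "b \<in> S" "continuous_on {a..b} \<gamma>"
    "\<And>t. t \<in> {a..b} - S \<Longrightarrow> \<gamma> differentiable (at t)"
    "\<And>t. t \<in> {a..b} - S \<Longrightarrow> isCont (\<lambda>t. vector_derivative \<gamma> (at t)) t"
    "\<And>t. t \<in> {a..b} - S \<Longrightarrow> norm (vector_derivative \<gamma> (at t)) \<le> B"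
proof -
  let ?reg = "\<lambda>t B. \<gamma> differentiable (at t) \<and> isCont (\<lambda>t. vector_derivative \<gamma> (at t)) t
    \<and> norm (vector_derivative \<gamma> (at t)) \<le> B"
  have "\<exists>S B. finite S \<and> a \<in> S \<and> b \<in> S \<and> continuous_on {a..b} \<gamma> \<and> (\<forall>t\<in>{a..b} - S. ?reg t B)"
    using assms
  proof (induction rule: piecewise_C1.induct)
    case (refl a)
    show ?case by (rule exI [of _ "{a}"]) simp
  next
    case (step a b c)
    then obtain S B where S: "finite S" "a \<in> S" "b \<in> S" "continuous_on {a..b} \<gamma>"
      "\<And>t. t \<in> {a..b} - S \<Longrightarrow> ?reg t B"
      by blast
    obtain \<gamma>' where g: "continuous_on {b..c} \<gamma>'"
      "\<And>t. t \<in> {b..c} \<Longrightarrow> (\<gamma> has_vector_derivative \<gamma>' t) (at t within {b..c})"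
      using step(3) by (auto simp: C1_segment_def)
    have "bounded (\<gamma>' ` {b..c})"
      using g(1) compact_continuous_image compact_imp_bounded by blast
    then obtain B' where B': "\<And>t. t \<in> {b..c} \<Longrightarrow> norm (\<gamma>' t) \<le> B'"
      unfolding bounded_iff by blast
    have der: "(\<gamma> has_vector_derivative \<gamma>' t) (at t)" if "t \<in> {b<..<c}" for t
      using g(2) [of t] that at_within_Icc_at [of b t c] by auto
    have "?reg t (max B B')" if t: "t \<in> {b<..<c}" for t
    proof (intro conjI)
      show "\<gamma> differentiable (at t)"
        using der [OF t] differentiableI_vector by blast
      have "isCont \<gamma>' t"
        using continuous_on_interior [OF g(1)] t by simp
      moreover have "\<forall>\<^sub>F s in nhds t. vector_derivative \<gamma> (at s) = \<gamma>' s"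
        using t vector_derivative_at [OF der]
        by (auto intro!: eventually_nhds [THEN iffD2] exI [of _ "{b<..<c}"])
      ultimately show "isCont (\<lambda>t. vector_derivative \<gamma> (at t)) t"
        using isCont_cong [of "\<lambda>t. vector_derivative \<gamma> (at t)" \<gamma>' t] by blast
      show "norm (vector_derivative \<gamma> (at t)) \<le> max B B'"
        using B' [of t] t by (simp add: vector_derivative_at [OF der] le_max_iff_disj)
    qed
    moreover have "?reg t (max B B')" if "t \<in> {a..b} - S" for t
      using S(5) [OF that] by auto
    \<comment> \<open>The joint \<open>b\<close> belongs to \<open>S\<close>, so a remaining point
      lies in the old interval or strictly inside the new piece.\<close>
    moreover have "t \<in> {a..b} - S \<or> t \<in> {b<..<c}" if "t \<in> {a..c} - insert c S" for t
      using that S(3) by (cases "t \<le> b") (auto simp: less_le)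
    ultimately have "\<forall>t\<in>{a..c} - insert c S. ?reg t (max B B')"
      by blast
    moreover have "continuous_on {a..c} \<gamma>"
    proof -
      have "continuous_on {b..c} \<gamma>"
        using g(2) has_vector_derivative_continuous continuous_on_eq_continuous_within by blast
      then have "continuous_on ({a..b} \<union> {b..c}) \<gamma>"
        using S(4) by (intro continuous_on_closed_Un) auto
      then show ?thesis
        using piecewise_C1_le [OF step(1)] step(2) by (simp add: ivl_disj_un_two_touch(4))
    qed
    ultimately show ?case
      using S by (intro exI [of _ "insert c S"] exI [of _ "max B B'"]) auto
  qed
  then show thesis
    using that by blast
qed

definition curve_length :: "('a::real_normed_vector \<Rightarrow> 'a \<Rightarrow> real) \<Rightarrow> (real \<Rightarrow> 'a) \<Rightarrow> real \<Rightarrow> real \<Rightarrow> real"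
  where "curve_length K \<gamma> a b = integral {a..b} (\<lambda>t. K (\<gamma> t) (vector_derivative \<gamma> (at t)))"

text \<open>Carries an upper bound for a length, so that estimates add up without infima; the free
  parameter interval lets curves be concatenated by a mere translation.\<close>

definition joinable :: "(complex^2) set \<Rightarrow> (complex^2 \<Rightarrow> complex^2 \<Rightarrow> real) \<Rightarrow> complex^2 \<Rightarrow> complex^2 \<Rightarrow> real \<Rightarrow> bool" where
  "joinable \<Omega> K x y c \<longleftrightarrow>
     (\<exists>\<gamma> a b. a < b \<and> piecewise_C1 \<gamma> a b \<and> \<gamma> ` {a..b} \<subseteq> \<Omega> \<and> \<gamma> a = x \<and> \<gamma> b = y \<and>
        curve_length K \<gamma> a b \<le> c)"

section \<open>Upper semicontinuous metrics along curves\<close>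

context
  fixes \<Omega> :: "(complex^2) set" and K :: "complex^2 \<Rightarrow> complex^2 \<Rightarrow> real"
  assumes finsler: "finsler_metric \<Omega> K" and open_dom: "open \<Omega>"
    and nonneg: "\<forall>z\<in>\<Omega>. \<forall>X. 0 \<le> K z X"
begin

lemma finsler_scale:
  assumes "z \<in> \<Omega>"
  shows "K z (a *\<^sub>R X) = \<bar>a\<bar> * K z X"
  using finsler assms by (simp add: finsler_metric_def scaleR_eq_vec_scale)

lemma finsler_zero: "z \<in> \<Omega> \<Longrightarrow> K z 0 = 0"
  using finsler_scale [of z 0 0] by simp

text \<open>The neighbourhood includes the point itself, which the punctured filter in
  \<open>upper_semicontinuous_on\<close> omits.\<close>

lemma finsler_usc:
  assumes "z \<in> \<Omega>" "K z X < c"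
  obtains T where "open T" "(z, X) \<in> T" "\<And>w Y. (w, Y) \<in> T \<Longrightarrow> w \<in> \<Omega> \<Longrightarrow> K w Y < c"
proof -
  let ?K = "\<lambda>(z, X). K z X"
  have "upper_semicontinuous_on (\<Omega> \<times> UNIV) ?K"
    using finsler by (simp add: finsler_metric_def)
  then have "(z, X) \<in> \<Omega> \<times> UNIV \<longrightarrow> ?K (z, X) < c \<longrightarrow>
      (\<forall>\<^sub>F y in at (z, X) within \<Omega> \<times> UNIV. ?K y < c)"
    unfolding upper_semicontinuous_on_def by blast
  then have "\<forall>\<^sub>F y in at (z, X) within \<Omega> \<times> UNIV. ?K y < c"
    using assms by simp
  then obtain T where T: "open T" "(z, X) \<in> T"
    "\<And>y. y \<in> T \<Longrightarrow> y \<noteq> (z, X) \<Longrightarrow> y \<in> \<Omega> \<times> UNIV \<Longrightarrow> ?K y < c"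
    unfolding eventually_at_topological by blast
  have "K w Y < c" if "(w, Y) \<in> T" "w \<in> \<Omega>" for w Y
    using T(3) [of "(w, Y)"] that assms(2) by (cases "(w, Y) = (z, X)") auto
  with T(1,2) show thesis
    by (rule that)
qed

text \<open>Upper semicontinuity at \<open>(z, 0)\<close>, where the metric vanishes, combined with homogeneity.\<close>

lemma finsler_locally_bounded:
  assumes "z \<in> \<Omega>"
  obtains \<rho> B where "0 < \<rho>" "0 \<le> B" "ball z \<rho> \<subseteq> \<Omega>"
    "\<And>w X. w \<in> ball z \<rho> \<Longrightarrow> K w X \<le> B * norm X"
proof -
  obtain T where T: "open T" "(z, 0) \<in> T" "\<And>w Y. (w, Y) \<in> T \<Longrightarrow> w \<in> \<Omega> \<Longrightarrow> K w Y < 1"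
    using finsler_usc [OF assms, of 0 1] finsler_zero [OF assms] by auto
  obtain U V where UV: "open U" "open V" "z \<in> U" "0 \<in> V" "U \<times> V \<subseteq> T"
    by (rule open_prod_elim [OF T(1,2)]) auto
  obtain \<rho> where \<rho>: "0 < \<rho>" "ball z \<rho> \<subseteq> U \<inter> \<Omega>"
    using openE [OF open_Int [OF UV(1) open_dom], of z] UV(3) assms by auto
  obtain \<eta> where \<eta>: "0 < \<eta>" "cball 0 \<eta> \<subseteq> V"
    using UV open_contains_cball by blast
  have "K w X \<le> 1 / \<eta> * norm X" if w: "w \<in> ball z \<rho>" for w X
  proof (cases "X = 0")
    case False
    have "w \<in> \<Omega>"
      using w \<rho> by blast
    \<comment> \<open>\<open>X\<close> is rescaled to length \<open>\<eta>\<close>, where the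
      semicontinuity bound applies; homogeneity undoes the scaling.\<close>
    have "K w ((\<eta> / norm X) *\<^sub>R X) < 1"
      using w \<rho> \<eta> UV(5) \<open>w \<in> \<Omega>\<close> False
      by (intro T(3)) (auto intro!: subsetD [OF UV(5)] subsetD [OF \<eta>(2)])
    then show ?thesis
      using \<open>w \<in> \<Omega>\<close> False \<eta>(1) by (simp add: finsler_scale field_simps)
  qed (use w \<rho> finsler_zero in auto)
  then show thesis
    using \<rho> \<eta>(1) by (intro that [of \<rho> "1 / \<eta>"]) auto
qed

lemma finsler_bounded_on_compact:
  assumes "compact T" "T \<subseteq> \<Omega>"
  obtains B where "0 \<le> B" "\<And>w X. w \<in> T \<Longrightarrow> K w X \<le> B * norm X"
proof -
  let ?bound = "\<lambda>z p. 0 < fst p \<and> 0 \<le> snd p \<and> (\<forall>w\<in>ball z (fst p). \<forall>X. K w X \<le> snd p * norm X)"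
  have "\<forall>z\<in>T. \<exists>p. ?bound z p"
  proof
    fix z assume "z \<in> T"
    then have "z \<in> \<Omega>"
      using assms(2) by blast
    then show "\<exists>p. ?bound z p"
    proof (rule finsler_locally_bounded)
      fix \<rho> B
      assume "0 < \<rho>" "0 \<le> B" "ball z \<rho> \<subseteq> \<Omega>" "\<And>w X. w \<in> ball z \<rho> \<Longrightarrow> K w X \<le> B * norm X"
      then show ?thesis
        by (intro exI [of _ "(\<rho>, B)"]) simp
    qed
  qed
  from bchoice [OF this] obtain p where p: "\<forall>z\<in>T. ?bound z (p z)"
    by blast
  define \<rho> B where "\<rho> z = fst (p z)" and "B z = snd (p z)" for z
  have B: "0 < \<rho> z \<and> 0 \<le> B z \<and> (\<forall>w\<in>ball z (\<rho> z). \<forall>X. K w X \<le> B z * norm X)" if "z \<in> T" for z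
    using p that by (simp add: \<rho>_def B_def)
  obtain F where F: "F \<subseteq> T" "finite F" "T \<subseteq> (\<Union>z\<in>F. ball z (\<rho> z))"
  proof (rule compactE_image [OF \<open>compact T\<close>, of T "\<lambda>z. ball z (\<rho> z)"])
    show "T \<subseteq> (\<Union>z\<in>T. ball z (\<rho> z))"
      using B by force
  qed auto
  show thesis
  proof (rule that [of "sum B F"])
    show "0 \<le> sum B F"
      using B F by (intro sum_nonneg) blast
    fix w X assume "w \<in> T"
    then obtain z where z: "z \<in> F" "w \<in> ball z (\<rho> z)"
      using F by blast
    have "K w X \<le> B z * norm X"
      using B z F by blast
    also have "\<dots> \<le> sum B F * norm X"
      using z F B by (intro mult_right_mono member_le_sum) auto
    finally show "K w X \<le> sum B F * norm X" .
  qed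
qed

text \<open>Off finitely many points the curve and its velocity are continuous, so the integrand has
  open strict sublevel sets and is measurable; it is bounded because the image of the curve is
  compact and its velocity bounded.\<close>

lemma curve_length_integrable:
  assumes "piecewise_C1 \<gamma> a b" "\<gamma> ` {a..b} \<subseteq> \<Omega>"
  shows "(\<lambda>t. K (\<gamma> t) (vector_derivative \<gamma> (at t))) integrable_on {a..b}"
proof -
  let ?v = "\<lambda>t. vector_derivative \<gamma> (at t)"
  let ?f = "\<lambda>t. K (\<gamma> t) (?v t)"
  obtain S B where S: "finite S" "a \<in> S" "b \<in> S" "continuous_on {a..b} \<gamma>"
    and v: "\<And>t. t \<in> {a..b} - S \<Longrightarrow> isCont ?v t" "\<And>t. t \<in> {a..b} - S \<Longrightarrow> norm (?v t) \<le> B"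
    by (rule piecewise_C1_regularity [OF assms(1)]) blast
  define G where "G = {a..b} - S"
  have G: "G = {a<..<b} - S"
    using S by (auto simp: G_def less_le)
  then have "open G"
    using S(1) by (simp add: open_Diff finite_imp_closed)
  have spike: "f integrable_on G \<longleftrightarrow> f integrable_on {a..b}" for f :: "real \<Rightarrow> real"
    by (rule integrable_spike_set_eq; rule negligible_subset [OF negligible_finite [OF S(1)]])
      (auto simp: G_def)
  have cont: "continuous_on G (\<lambda>t. (\<gamma> t, ?v t))"
  proof (intro continuous_on_Pair)
    show "continuous_on G \<gamma>"
      using S(4) by (rule continuous_on_subset) (auto simp: G_def)
    show "continuous_on G ?v"
      using v(1) by (intro continuous_at_imp_continuous_on) (simp add: G_def)
  qed
  have inG: "\<gamma> t \<in> \<Omega>" if "t \<in> G" for t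
    using that assms(2) by (auto simp: G_def)
  obtain B' where B': "0 \<le> B'" "\<And>w X. w \<in> \<gamma> ` {a..b} \<Longrightarrow> K w X \<le> B' * norm X"
    using finsler_bounded_on_compact [OF compact_continuous_image [OF S(4)] assms(2)] by auto
  have "open {t \<in> G. ?f t < c}" for c
  proof (subst open_subopen, intro ballI)
    fix t assume "t \<in> {t \<in> G. ?f t < c}"
    then have t: "t \<in> G" "?f t < c"
      by auto
    then obtain T where T: "open T" "(\<gamma> t, ?v t) \<in> T" "\<And>w Y. (w, Y) \<in> T \<Longrightarrow> w \<in> \<Omega> \<Longrightarrow> K w Y < c"
      using finsler_usc [OF inG [OF t(1)] t(2)] by blast
    have "open (G \<inter> (\<lambda>t. (\<gamma> t, ?v t)) -` T)"
      using continuous_open_preimage [OF cont \<open>open G\<close> T(1)] .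
    then show "\<exists>U. open U \<and> t \<in> U \<and> U \<subseteq> {t \<in> G. ?f t < c}"
      using t(1) T(2,3) inG by (intro exI [of _ "G \<inter> (\<lambda>t. (\<gamma> t, ?v t)) -` T"]) auto
  qed
  then have "?f \<in> borel_measurable (lebesgue_on G)"
    using \<open>open G\<close>
    by (auto simp: borel_measurable_iff_less sets_restrict_space_iff intro!: lborelD borel_open)
  moreover have "\<bar>?f t\<bar> \<le> B' * B" if "t \<in> G" for t
  proof -
    have "?f t \<le> B' * norm (?v t)"
      using that B'(2) by (auto simp: G_def)
    also have "\<dots> \<le> B' * B"
      using v(2) that B'(1) by (intro mult_left_mono) (auto simp: G_def)
    finally show ?thesis
      using nonneg inG [OF that] by simp
  qed
  moreover have "(\<lambda>t. B' * B) integrable_on G"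
    using integrable_const_ivl [of "B' * B" a b] by (simp add: spike)
  ultimately have "?f integrable_on G"
    using \<open>open G\<close>
    by (intro measurable_bounded_by_integrable_imp_integrable_real [of ?f G "\<lambda>t. B' * B"])
      (auto intro!: lborelD borel_open)
  then show ?thesis
    by (simp add: spike)
qed

end

text \<open>The derivative depends on a two-sided neighbourhood, so agreement on the closed interval
  determines it except at the two end points, a null set.\<close>

lemma curve_length_cong:
  assumes "\<And>t. t \<in> {a..b} \<Longrightarrow> \<eta> t = \<gamma> t"
  shows "curve_length K \<eta> a b = curve_length K \<gamma> a b"
  unfolding curve_length_def
proof (rule integral_spike [of "{a, b}"])
  fix t assume t: "t \<in> {a..b} - {a, b}"
  then have "\<forall>\<^sub>F s in nhds t. s \<in> UNIV \<longrightarrow> \<gamma> s = \<eta> s"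
    using assms by (intro eventually_nhds [THEN iffD2] exI [of _ "{a<..<b}"]) auto
  then have "vector_derivative \<gamma> (at t) = vector_derivative \<eta> (at t)"
    by (intro vector_derivative_cong_eq) auto
  then show "K (\<gamma> t) (vector_derivative \<gamma> (at t)) = K (\<eta> t) (vector_derivative \<eta> (at t))"
    using assms t by simp
qed simp

lemma joinable_mono: "joinable \<Omega> K x y c \<Longrightarrow> c \<le> c' \<Longrightarrow> joinable \<Omega> K x y c'"
  unfolding joinable_def using order_trans [of _ c c'] by blast

section \<open>Length estimates and concatenation of curves\<close>

context
  fixes \<Omega> :: "(complex^2) set" and K :: "complex^2 \<Rightarrow> complex^2 \<Rightarrow> real"
  assumes finsler: "finsler_metric \<Omega> K" and open_dom: "open \<Omega>"
    and nonneg: "\<forall>z\<in>\<Omega>. \<forall>X. 0 \<le> K z X"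
begin

lemma curve_length_subinterval_nonneg:
  assumes "piecewise_C1 \<gamma> a b" "\<gamma> ` {a..b} \<subseteq> \<Omega>" "a \<le> u" "v \<le> b"
  shows "0 \<le> curve_length K \<gamma> u v"
proof -
  have "(\<lambda>t. K (\<gamma> t) (vector_derivative \<gamma> (at t))) integrable_on {u..v}"
    by (rule integrable_subinterval_real
        [OF curve_length_integrable [OF finsler open_dom nonneg assms(1,2)]]) (use assms in auto)
  moreover have "\<gamma> t \<in> \<Omega>" if "t \<in> {u..v}" for t
    using that assms(3,4) by (intro subsetD [OF assms(2)] imageI) auto
  ultimately show ?thesis
    unfolding curve_length_def using nonneg by (intro integral_nonneg) auto
qed

lemma curve_length_combine:
  assumes "piecewise_C1 \<gamma> a b" "\<gamma> ` {a..b} \<subseteq> \<Omega>" "a \<le> u" "u \<le> b"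
  shows "curve_length K \<gamma> a b = curve_length K \<gamma> a u + curve_length K \<gamma> u b"
  using Henstock_Kurzweil_Integration.integral_combine
    [OF assms(3,4) curve_length_integrable [OF finsler open_dom nonneg assms(1,2)]]
  by (simp add: curve_length_def)

text \<open>A calibration: the fundamental theorem of calculus for \<open>f\<close> along the curve,
  with the differential of \<open>f\<close> dominated by \<open>K\<close>.\<close>

lemma curve_length_lower_bound:
  assumes "piecewise_C1 \<gamma> a b" "\<gamma> ` {a..b} \<subseteq> \<Omega>" "a \<le> u" "u \<le> v" "v \<le> b"
    and f: "\<And>t. t \<in> {u..v} \<Longrightarrow> (f has_derivative f' (\<gamma> t)) (at (\<gamma> t))"
    and f_le: "\<And>t X. t \<in> {u..v} \<Longrightarrow> f' (\<gamma> t) X \<le> K (\<gamma> t) X"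
  shows "f (\<gamma> v) - f (\<gamma> u) \<le> curve_length K \<gamma> u v"
proof -
  let ?v = "\<lambda>t. vector_derivative \<gamma> (at t)"
  obtain S where S: "finite S" "continuous_on {a..b} \<gamma>"
    "\<And>t. t \<in> {a..b} - S \<Longrightarrow> \<gamma> differentiable (at t)"
    by (rule piecewise_C1_regularity [OF assms(1)]) blast
  have "((\<lambda>t. f' (\<gamma> t) (?v t)) has_integral f (\<gamma> v) - f (\<gamma> u)) {u..v}"
  proof (rule fundamental_theorem_of_calculus_interior_strong [OF S(1) \<open>u \<le> v\<close>])
    fix t assume t: "t \<in> {u<..<v} - S"
    then have "(\<gamma> has_vector_derivative ?v t) (at t)"
      using S(3) [of t] assms(3,5) by (simp add: vector_derivative_works [symmetric])
    then have "((\<lambda>s. f (\<gamma> s)) has_derivative (\<lambda>h. f' (\<gamma> t) (h *\<^sub>R ?v t))) (at t)"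
      using f [of t] t unfolding has_vector_derivative_def
      by (intro has_derivative_compose [of \<gamma> _ _ _ f]) auto
    moreover have "linear (f' (\<gamma> t))"
      using f [of t] t has_derivative_linear by auto
    ultimately show "((\<lambda>s. f (\<gamma> s)) has_vector_derivative f' (\<gamma> t) (?v t)) (at t)"
      by (simp add: has_vector_derivative_def linear_scale)
  next
    have "continuous_on {u..v} \<gamma>"
      using S(2) by (rule continuous_on_subset) (use assms in auto)
    moreover have "continuous_on (\<gamma> ` {u..v}) f"
      using f has_derivative_continuous by (intro continuous_at_imp_continuous_on) blast
    ultimately show "continuous_on {u..v} (\<lambda>s. f (\<gamma> s))"
      using continuous_on_compose2 by blast
  qed
  moreover have "(\<lambda>t. K (\<gamma> t) (?v t)) integrable_on {u..v}"
    by (rule integrable_subinterval_real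
        [OF curve_length_integrable [OF finsler open_dom nonneg assms(1,2)]]) (use assms in auto)
  ultimately show ?thesis
    unfolding curve_length_def using f_le
    by (intro has_integral_le [OF _ integrable_integral]) auto
qed

text \<open>By homogeneity of \<open>K\<close> the factor \<open>k\<close> in the velocity cancels
  against the change of variables.\<close>

lemma curve_length_affine:
  assumes "piecewise_C1 \<gamma> a b" "\<gamma> ` {a..b} \<subseteq> \<Omega>" "0 < k"
  shows "curve_length K (\<lambda>t. \<gamma> (k * t + d)) ((a - d) / k) ((b - d) / k) = curve_length K \<gamma> a b"
proof -
  let ?v = "\<lambda>t. vector_derivative \<gamma> (at t)"
  let ?f = "\<lambda>t. K (\<gamma> t) (?v t)"
  let ?I = "{(a - d) / k..(b - d) / k}"
  obtain S where S: "finite S" "\<And>t. t \<in> {a..b} - S \<Longrightarrow> \<gamma> differentiable (at t)"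
    by (rule piecewise_C1_regularity [OF assms(1)]) blast
  have "(?f has_integral curve_length K \<gamma> a b) (cbox a b)"
    using curve_length_integrable [OF finsler open_dom nonneg assms(1,2)]
    by (simp add: curve_length_def integrable_integral)
  from has_integral_affinity [OF this, of k d] \<open>0 < k\<close>
  have "((\<lambda>x. ?f (k * x + d)) has_integral curve_length K \<gamma> a b / k)
      ((\<lambda>x. x / k - d / k) ` {a..b})"
    by (simp add: divide_inverse mult.commute)
  moreover have "(\<lambda>x. x / k - d / k) ` {a..b} = ?I"
  proof (intro set_eqI iffI)
    fix t assume "t \<in> ?I"
    then have "k * t + d \<in> {a..b}" "t = (k * t + d) / k - d / k"
      using \<open>0 < k\<close> by (auto simp: field_simps)
    then show "t \<in> (\<lambda>x. x / k - d / k) ` {a..b}"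
      by blast
  qed (use \<open>0 < k\<close> in \<open>auto simp: field_simps\<close>)
  ultimately have "((\<lambda>x. ?f (k * x + d)) has_integral curve_length K \<gamma> a b / k) ?I"
    by simp
  from has_integral_mult_right [OF this, of k] \<open>0 < k\<close>
  have "((\<lambda>x. k * ?f (k * x + d)) has_integral curve_length K \<gamma> a b) ?I"
    by simp
  moreover have "finite ((\<lambda>s. (s - d) / k) ` S)"
    using S(1) by simp
  ultimately have "((\<lambda>t. K (\<gamma> (k * t + d)) (vector_derivative (\<lambda>t. \<gamma> (k * t + d)) (at t)))
      has_integral curve_length K \<gamma> a b) ?I"
  proof (rule has_integral_spike_finite [rotated 2])
    fix t assume t: "t \<in> ?I - (\<lambda>s. (s - d) / k) ` S"
    then have mem: "k * t + d \<in> {a..b}"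
      using \<open>0 < k\<close> by (auto simp: field_simps)
    moreover have "k * t + d \<notin> S"
    proof
      assume "k * t + d \<in> S"
      moreover have "t = ((k * t + d) - d) / k"
        using \<open>0 < k\<close> by simp
      ultimately show False
        using t by blast
    qed
    ultimately have "(\<gamma> has_vector_derivative ?v (k * t + d)) (at (k * t + d))"
      using S(2) by (simp add: vector_derivative_works [symmetric])
    moreover have "((\<lambda>t. k * t + d) has_vector_derivative k) (at t)"
      unfolding has_real_derivative_iff_has_vector_derivative [symmetric]
      by (auto intro!: derivative_eq_intros)
    ultimately have "(\<gamma> \<circ> (\<lambda>t. k * t + d) has_vector_derivative k *\<^sub>R ?v (k * t + d)) (at t)"
      by (intro vector_diff_chain_at)
    then have "vector_derivative (\<lambda>t. \<gamma> (k * t + d)) (at t) = k *\<^sub>R ?v (k * t + d)"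
      by (intro vector_derivative_at) (simp only: o_def)
    moreover have "\<gamma> (k * t + d) \<in> \<Omega>"
      using mem assms(2) by blast
    ultimately show "K (\<gamma> (k * t + d)) (vector_derivative (\<lambda>t. \<gamma> (k * t + d)) (at t))
        = k * ?f (k * t + d)"
      using \<open>0 < k\<close> by (simp add: finsler_scale [OF finsler open_dom nonneg])
  qed
  then show ?thesis
    unfolding curve_length_def [of K "\<lambda>t. \<gamma> (k * t + d)"] by (rule integral_unique)
qed

lemma joinable_trans:
  assumes "joinable \<Omega> K x y c" "joinable \<Omega> K y z d"
  shows "joinable \<Omega> K x z (c + d)"
proof -
  obtain \<alpha> a b where \<alpha>: "a < b" "piecewise_C1 \<alpha> a b" "\<alpha> ` {a..b} \<subseteq> \<Omega>" "\<alpha> a = x" "\<alpha> b = y"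
    "curve_length K \<alpha> a b \<le> c"
    using assms(1) unfolding joinable_def by blast
  obtain \<beta> a' b' where \<beta>: "a' < b'" "piecewise_C1 \<beta> a' b'" "\<beta> ` {a'..b'} \<subseteq> \<Omega>" "\<beta> a' = y" "\<beta> b' = z"
    "curve_length K \<beta> a' b' \<le> d"
    using assms(2) unfolding joinable_def by blast
  define e where "e = b + b' - a'"
  \<comment> \<open>The second curve is shifted to start at \<open>b\<close>; the factor 1 matches
    the shape \<open>k * t + d\<close> of the affine lemmas.\<close>
  define \<eta> where "\<eta> t = \<beta> (1 * t + (a' - b))" for t
  have \<eta>: "piecewise_C1 \<eta> b e" "curve_length K \<eta> b e \<le> d" "\<eta> b = y" "\<eta> e = z"
    using piecewise_C1_affine [OF \<beta>(2), of 1 "a' - b"] curve_length_affine [OF \<beta>(2,3), of 1 "a' - b"]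
      \<beta>(4-6)
    by (simp_all add: \<eta>_def [abs_def] e_def algebra_simps)
  have \<eta>_img: "\<eta> t \<in> \<Omega>" if "t \<in> {b..e}" for t
    using \<beta>(3) that by (auto simp: \<eta>_def e_def)
  define \<gamma> where "\<gamma> t = (if t \<le> b then \<alpha> t else \<eta> t)" for t
  have eq: "\<gamma> t = \<alpha> t" if "t \<in> {a..b}" for t
    using that by (simp add: \<gamma>_def)
  have eq': "\<gamma> t = \<eta> t" if "t \<in> {b..e}" for t
    using that \<alpha>(5) \<eta>(3) by (auto simp: \<gamma>_def)
  have pw: "piecewise_C1 \<gamma> a e"
    using piecewise_C1_trans [OF piecewise_C1_cong [OF \<eta>(1) eq'] piecewise_C1_cong [OF \<alpha>(2) eq]] .
  have img: "\<gamma> ` {a..e} \<subseteq> \<Omega>"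
    using \<alpha>(3) \<eta>_img by (auto simp: \<gamma>_def)
  have "curve_length K \<gamma> a e = curve_length K \<gamma> a b + curve_length K \<gamma> b e"
    by (rule curve_length_combine [OF pw img]) (use \<alpha>(1) \<beta>(1) in \<open>auto simp: e_def\<close>)
  also have "\<dots> = curve_length K \<alpha> a b + curve_length K \<eta> b e"
    using curve_length_cong [of a b \<gamma> \<alpha> K] curve_length_cong [of b e \<gamma> \<eta> K] eq eq' by simp
  also have "\<dots> \<le> c + d"
    using \<alpha>(6) \<eta>(2) by simp
  finally have "curve_length K \<gamma> a e \<le> c + d" .
  moreover have "a < e" "\<gamma> a = x" "\<gamma> e = z"
    using \<alpha>(1,4) \<beta>(1) \<eta>(4) by (auto simp: \<gamma>_def e_def)
  ultimately show ?thesis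
    unfolding joinable_def using pw img by blast
qed

lemma joinable_unit_interval:
  assumes "joinable \<Omega> K x y c"
  obtains \<gamma> where "piecewise_C1 \<gamma> 0 1" "\<gamma> ` {0..1} \<subseteq> \<Omega>" "\<gamma> 0 = x" "\<gamma> 1 = y"
    "curve_length K \<gamma> 0 1 \<le> c"
proof -
  obtain \<alpha> a b where \<alpha>: "a < b" "piecewise_C1 \<alpha> a b" "\<alpha> ` {a..b} \<subseteq> \<Omega>" "\<alpha> a = x" "\<alpha> b = y"
    "curve_length K \<alpha> a b \<le> c"
    using assms unfolding joinable_def by blast
  show thesis
  proof (rule that [of "\<lambda>t. \<alpha> ((b - a) * t + a)"])
    show "piecewise_C1 (\<lambda>t. \<alpha> ((b - a) * t + a)) 0 1"
      using piecewise_C1_affine [OF \<alpha>(2), of "b - a" a] \<alpha>(1) by simp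
    show "curve_length K (\<lambda>t. \<alpha> ((b - a) * t + a)) 0 1 \<le> c"
      using curve_length_affine [OF \<alpha>(2,3), of "b - a" a] \<alpha>(1,6) by simp
    show "(\<lambda>t. \<alpha> ((b - a) * t + a)) ` {0..1} \<subseteq> \<Omega>"
    proof
      fix w assume "w \<in> (\<lambda>t. \<alpha> ((b - a) * t + a)) ` {0..1}"
      then obtain t where t: "0 \<le> t" "t \<le> 1" "w = \<alpha> ((b - a) * t + a)"
        by auto
      have "(b - a) * t \<le> (b - a) * 1" "0 \<le> (b - a) * t"
        using t \<alpha>(1) by (auto intro: mult_left_mono)
      then show "w \<in> \<Omega>"
        using \<alpha>(3) t(3) by auto
    qed
  qed (use \<alpha> in auto)
qed

lemma finsler_dist_le:
  assumes "joinable \<Omega> K x y c"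
  shows "finsler_dist \<Omega> K x y \<le> c"
proof -
  obtain \<gamma> where \<gamma>: "piecewise_C1 \<gamma> 0 1" "\<gamma> ` {0..1} \<subseteq> \<Omega>" "\<gamma> 0 = x" "\<gamma> 1 = y"
    "curve_length K \<gamma> 0 1 \<le> c"
    using joinable_unit_interval [OF assms] .
  have "finsler_dist \<Omega> K x y \<le> curve_length K \<gamma> 0 1"
    unfolding finsler_dist_def piecewise_C1_curve_iff curve_length_def [symmetric]
  proof (rule cInf_lower)
    show "bdd_below {curve_length K \<gamma> 0 1 |\<gamma>.
        piecewise_C1 \<gamma> 0 1 \<and> \<gamma> ` {0..1} \<subseteq> \<Omega> \<and> \<gamma> 0 = x \<and> \<gamma> 1 = y}"
      by (intro bdd_belowI [of _ 0]) (auto intro: curve_length_subinterval_nonneg)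
  qed (use \<gamma> in blast)
  with \<gamma>(5) show ?thesis by simp
qed

text \<open>The \<open>joinable\<close> premise guarantees that some curve exists, since
  \<open>Inf\<close> of the empty set is unspecified.\<close>

lemma finsler_dist_ge:
  assumes "joinable \<Omega> K x y c0"
    and "\<And>\<gamma>. piecewise_C1 \<gamma> 0 1 \<Longrightarrow> \<gamma> ` {0..1} \<subseteq> \<Omega> \<Longrightarrow> \<gamma> 0 = x \<Longrightarrow> \<gamma> 1 = y \<Longrightarrow>
      c \<le> curve_length K \<gamma> 0 1"
  shows "c \<le> finsler_dist \<Omega> K x y"
  unfolding finsler_dist_def piecewise_C1_curve_iff curve_length_def [symmetric]
proof (rule cInf_greatest)
  show "{curve_length K \<gamma> 0 1 |\<gamma>.
      piecewise_C1 \<gamma> 0 1 \<and> \<gamma> ` {0..1} \<subseteq> \<Omega> \<and> \<gamma> 0 = x \<and> \<gamma> 1 = y} \<noteq> {}"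
    using joinable_unit_interval [OF assms(1)] by blast
qed (use assms(2) in blast)

lemma joinable_segment:
  assumes "closed_segment x y \<subseteq> \<Omega>"
    and le: "\<And>t. t \<in> {0..1} \<Longrightarrow> K (x + t *\<^sub>R (y - x)) (y - x) \<le> g t"
    and g: "(g has_integral c) {0..1}"
  shows "joinable \<Omega> K x y c"
proof -
  define \<gamma> where "\<gamma> t = x + t *\<^sub>R (y - x)" for t :: real
  have der: "(\<gamma> has_vector_derivative (y - x)) F" for F
    unfolding \<gamma>_def [abs_def] has_vector_derivative_def by (auto intro!: derivative_eq_intros)
  have "C1_segment \<gamma> 0 1"
    unfolding C1_segment_def using der by (intro exI [of _ "\<lambda>_. y - x"]) simp
  then have pw: "piecewise_C1 \<gamma> 0 1"
    by (rule piecewise_C1.step [OF piecewise_C1.refl zero_less_one])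
  have img: "\<gamma> ` {0..1} \<subseteq> \<Omega>"
  proof -
    have "\<gamma> t \<in> closed_segment x y" if "t \<in> {0..1}" for t
      using that by (auto simp: \<gamma>_def in_segment algebra_simps)
    then show ?thesis
      using assms(1) by blast
  qed
  have "curve_length K \<gamma> 0 1 \<le> integral {0..1} g"
    unfolding curve_length_def
  proof (rule integral_le [OF curve_length_integrable [OF finsler open_dom nonneg pw img]])
    fix t :: real assume "t \<in> {0..1}"
    then show "K (\<gamma> t) (vector_derivative \<gamma> (at t)) \<le> g t"
      using le by (simp add: vector_derivative_at [OF der] \<gamma>_def)
  qed (use g in auto)
  moreover have "integral {0..1} g = c"
    using g by (rule integral_unique)
  moreover have "\<gamma> 0 = x" "\<gamma> 1 = y"
    by (simp_all add: \<gamma>_def)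
  ultimately show ?thesis
    unfolding joinable_def using pw img zero_less_one by metis
qed

lemma joinable_segment_const:
  assumes "closed_segment x y \<subseteq> \<Omega>"
    and "\<And>w. w \<in> closed_segment x y \<Longrightarrow> K w (y - x) \<le> c"
  shows "joinable \<Omega> K x y c"
proof (rule joinable_segment [OF assms(1)])
  fix t :: real assume "t \<in> {0..1}"
  then have "x + t *\<^sub>R (y - x) \<in> closed_segment x y"
    by (auto simp: in_segment algebra_simps)
  then show "K (x + t *\<^sub>R (y - x)) (y - x) \<le> c"
    by (rule assms(2))
next
  show "((\<lambda>_. c) has_integral c) {0..1 :: real}"
    using has_integral_const_real [of c 0 1] by simp
qed

text \<open>On a small ball \<open>K\<close> is at most \<open>B\<close> times the norm, so one
  bound \<open>B * (2 * \<rho>)\<close> serves all segments.\<close>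

lemma locally_joinable:
  assumes "z \<in> \<Omega>"
  obtains \<rho> c where "0 < \<rho>" "ball z \<rho> \<subseteq> \<Omega>"
    "\<And>x y. x \<in> ball z \<rho> \<Longrightarrow> y \<in> ball z \<rho> \<Longrightarrow> joinable \<Omega> K x y c"
proof (rule finsler_locally_bounded [OF finsler open_dom nonneg assms])
  fix \<rho> B
  assume B: "0 < \<rho>" "0 \<le> B" "ball z \<rho> \<subseteq> \<Omega>" "\<And>w X. w \<in> ball z \<rho> \<Longrightarrow> K w X \<le> B * norm X"
  have "joinable \<Omega> K x y (B * (2 * \<rho>))" if "x \<in> ball z \<rho>" "y \<in> ball z \<rho>" for x y
  proof (rule joinable_segment_const)
    have sub: "closed_segment x y \<subseteq> ball z \<rho>"
      using that by (simp add: closed_segment_subset)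
    then show "closed_segment x y \<subseteq> \<Omega>"
      using B(3) by blast
    fix w assume "w \<in> closed_segment x y"
    then have "K w (y - x) \<le> B * norm (y - x)"
      using sub B(4) by blast
    also have "norm (y - x) \<le> 2 * \<rho>"
      using that dist_triangle [of y x z] by (simp add: dist_norm [symmetric] dist_commute)
    then have "B * norm (y - x) \<le> B * (2 * \<rho>)"
      using B(2) by (rule mult_left_mono)
    finally show "K w (y - x) \<le> B * (2 * \<rho>)" .
  qed
  with B show thesis
    using that by blast
qed

lemma joinable_exists:
  assumes "connected \<Omega>" "x \<in> \<Omega>" "y \<in> \<Omega>"
  shows "\<exists>c. joinable \<Omega> K x y c"
proof -
  \<comment> \<open>Both directions are recorded because an equivalence relation is required and
    \<open>joinable\<close> is not symmetric by its form.\<close>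
  let ?R = "\<lambda>x y. (\<exists>c. joinable \<Omega> K x y c) \<and> (\<exists>c. joinable \<Omega> K y x c)"
  have "?R x y"
  proof (rule connected_equivalence_relation [OF assms, of ?R])
    fix a assume "a \<in> \<Omega>"
    then show "\<exists>T. openin (top_of_set \<Omega>) T \<and> a \<in> T \<and> (\<forall>x\<in>T. ?R a x)"
    proof (rule locally_joinable)
      fix \<rho> c
      assume "0 < \<rho>" "ball a \<rho> \<subseteq> \<Omega>"
        "\<And>x y. x \<in> ball a \<rho> \<Longrightarrow> y \<in> ball a \<rho> \<Longrightarrow> joinable \<Omega> K x y c"
      then show ?thesis
        by (intro exI [of _ "ball a \<rho>"]) (meson centre_in_ball open_ball openin_open_eq open_dom)
    qed
  qed (use joinable_trans in blast)+
  then show ?thesis by blast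
qed

text \<open>A finite cover by balls with local constants reduces the claim to the finitely many
  pairs of centres: \<open>x\<close> goes to its centre \<open>u\<close>, then to \<open>v\<close>,
  then to \<open>y\<close>.\<close>

lemma uniformly_joinable_on_compact:
  assumes "connected \<Omega>" "compact T" "T \<subseteq> \<Omega>"
  obtains c where "\<And>x y. x \<in> T \<Longrightarrow> y \<in> T \<Longrightarrow> joinable \<Omega> K x y c"
proof -
  let ?good = "\<lambda>z p. 0 < fst p \<and> (\<forall>x\<in>ball z (fst p). \<forall>y\<in>ball z (fst p). joinable \<Omega> K x y (snd p))"
  have "\<forall>z\<in>T. \<exists>p. ?good z p"
  proof
    fix z assume "z \<in> T"
    then have "z \<in> \<Omega>"
      using assms(3) by blast
    then show "\<exists>p. ?good z p"
    proof (rule locally_joinable)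
      fix \<rho> c
      assume "0 < \<rho>" "\<And>x y. x \<in> ball z \<rho> \<Longrightarrow> y \<in> ball z \<rho> \<Longrightarrow> joinable \<Omega> K x y c"
      then show ?thesis
        by (intro exI [of _ "(\<rho>, c)"]) simp
    qed
  qed
  from bchoice [OF this] obtain p where p: "\<forall>z\<in>T. ?good z (p z)"
    by blast
  obtain F where F: "F \<subseteq> T" "finite F" "T \<subseteq> (\<Union>z\<in>F. ball z (fst (p z)))"
  proof (rule compactE_image [OF \<open>compact T\<close>, of T "\<lambda>z. ball z (fst (p z))"])
    show "T \<subseteq> (\<Union>z\<in>T. ball z (fst (p z)))"
      using p by force
  qed auto
  have "\<forall>q\<in>F \<times> F. \<exists>c. joinable \<Omega> K (fst q) (snd q) c"
    using joinable_exists [OF assms(1)] F(1) assms(3) by (auto simp: subset_iff)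
  from bchoice [OF this] obtain d where d: "\<forall>q\<in>F \<times> F. joinable \<Omega> K (fst q) (snd q) (d q)"
    by blast
  define h where "h q = snd (p (fst q)) + d q + snd (p (snd q))" for q
  have "bdd_above (h ` (F \<times> F))"
    using F(2) by simp
  then obtain c where c: "\<And>q. q \<in> F \<times> F \<Longrightarrow> h q \<le> c"
    unfolding bdd_above_def by blast
  have "joinable \<Omega> K x y c" if x: "x \<in> T" and y: "y \<in> T" for x y
  proof -
    obtain u v where uv: "u \<in> F" "x \<in> ball u (fst (p u))" "v \<in> F" "y \<in> ball v (fst (p v))"
      using F(3) x y by blast
    have "joinable \<Omega> K x u (snd (p u))"
      using p F(1) uv by auto
    moreover have "joinable \<Omega> K u v (d (u, v))"
      using d uv by force
    moreover have "joinable \<Omega> K v y (snd (p v))"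
      using p F(1) uv by auto
    ultimately have "joinable \<Omega> K x y (h (u, v))"
      unfolding h_def by (auto intro: joinable_trans)
    moreover have "h (u, v) \<le> c"
      using c uv by blast
    ultimately show ?thesis
      by (rule joinable_mono)
  qed
  then show thesis
    by (rule that)
qed

end

section \<open>Lower bound\<close>

text \<open>A truncated logarithm: it is \<open>C\<^sup>1\<close> on \<open>{0<..}\<close>, constant beyond \<open>h\<close>, and its slope
  \<open>1/s - 1/h\<close> leaves the part \<open>1/h\<close> of the weight \<open>1/s\<close> of the normal component unused.\<close>

definition trunc_ln :: "real \<Rightarrow> real \<Rightarrow> real" where
  "trunc_ln h s = (if s \<le> h then ln s - s / h else ln h - 1)"

text \<open>At the joint \<open>h\<close> both branches take the value \<open>ln h - 1\<close> with
  slope 0, so they glue differentiably.\<close>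

lemma trunc_ln_has_derivative:
  assumes "0 < h" "0 < s"
  shows "(trunc_ln h has_real_derivative (if s \<le> h then 1 / s - 1 / h else 0)) (at s)"
proof -
  have "((\<lambda>s. if s \<in> {..h} then ln s - s / h else ln h - 1) has_vector_derivative
      (if s \<in> {..h} then 1 / s - 1 / h else 0)) (at s within UNIV)"
  proof (rule has_vector_derivative_If_within_closures [where T = "{h<..}"])
    show "((\<lambda>s. ln s - s / h) has_vector_derivative 1 / s - 1 / h)
        (at s within {..h} \<union> closure {..h} \<inter> closure {h<..})"
      using assms unfolding has_real_derivative_iff_has_vector_derivative [symmetric]
      by (auto intro!: derivative_eq_intros)
  qed (use assms in auto)
  then show ?thesis
    by (simp add: has_real_derivative_iff_has_vector_derivative trunc_ln_def [abs_def])
qed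

lemma trunc_ln_le_ln: "0 < h \<Longrightarrow> 0 < s \<Longrightarrow> trunc_ln h s \<le> ln s"
  by (auto simp: trunc_ln_def intro: order_trans [of _ "ln h"])

lemma trunc_ln_top: "0 < h \<Longrightarrow> h \<le> s \<Longrightarrow> trunc_ln h s = ln h - 1"
  by (auto simp: trunc_ln_def)

lemma one_plus_power_le:
  fixes A :: real
  assumes "0 \<le> A" "1 \<le> m"
  shows "1 + A ^ m \<le> (1 + A) ^ m"
  using assms(2)
proof (induction m rule: nat_induct_at_least)
  case (Suc m)
  have "1 + A ^ Suc m \<le> (1 + A) * (1 + A ^ m)"
    using assms(1) by (simp add: algebra_simps)
  also have "\<dots> \<le> (1 + A) * (1 + A) ^ m"
    using Suc assms(1) by (intro mult_left_mono) auto
  finally show ?case by simp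
qed simp

text \<open>After \<open>one_plus_power_le\<close>, the inequality ln t <= t - 1 is applied to t =
  (1 + A) \<kappa>; the value of \<kappa> makes the resulting slope exactly
  \<open>k\<close>.\<close>

lemma ln_one_plus_power_le_linear:
  fixes k :: real
  assumes "0 < k" "1 \<le> m"
  obtains c where "\<And>A. 0 \<le> A \<Longrightarrow> 2 * ln (1 + A ^ m) \<le> k * A + c"
proof
  define \<kappa> where "\<kappa> = k / (2 * real m)"
  have \<kappa>: "0 < \<kappa>" "2 * real m * \<kappa> = k"
    using assms by (auto simp: \<kappa>_def)
  fix A :: real assume A: "0 \<le> A"
  have "ln (1 + A ^ m) \<le> ln ((1 + A) ^ m)"
    using one_plus_power_le [OF A assms(2)] A by (intro ln_mono) (auto simp: add_pos_nonneg)
  also have "\<dots> = real m * ln (1 + A)"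
    using A by (simp add: ln_realpow)
  also have "ln (1 + A) = ln ((1 + A) * \<kappa>) - ln \<kappa>"
    using A \<kappa> by (subst ln_mult) auto
  also have "ln ((1 + A) * \<kappa>) \<le> (1 + A) * \<kappa> - 1"
    using A \<kappa> by (intro ln_le_minus_one) (simp add: add_pos_nonneg)
  finally have "2 * ln (1 + A ^ m) \<le> 2 * (real m * ((1 + A) * \<kappa> - 1 - ln \<kappa>))"
    by (simp add: mult_left_mono)
  also have "\<dots> = k * A + (k - 2 * real m * (1 + ln \<kappa>))"
    using \<kappa>(2) by (simp add: algebra_simps)
  finally show "2 * ln (1 + A ^ m) \<le> k * A + (k - 2 * real m * (1 + ln \<kappa>))" .
qed

lemma g_fn_eq:
  assumes "0 < bdist \<Omega> x" "0 < bdist \<Omega> y"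
  shows "g_fn \<Omega> k x y = 2 * ln (norm (x - y) ^ k + max (bdist \<Omega> x) (bdist \<Omega> y))
    - ln (bdist \<Omega> x) - ln (bdist \<Omega> y)"
proof -
  have "0 < norm (x - y) ^ k + max (bdist \<Omega> x) (bdist \<Omega> y)"
    using assms by (intro add_nonneg_pos) auto
  moreover have "ln (sqrt (bdist \<Omega> x * bdist \<Omega> y)) = (ln (bdist \<Omega> x) + ln (bdist \<Omega> y)) / 2"
    using assms by (simp add: ln_sqrt ln_mult)
  ultimately show ?thesis
    using assms unfolding g_fn_def by (subst ln_div) (auto simp: right_diff_distrib)
qed

lemma bdist_continuous: "continuous_on S (bdist \<Omega>)"
  unfolding bdist_def [abs_def] by (intro continuous_intros)

lemma bounded_domain_bounds:
  assumes "smoothly_bounded_domain \<Omega> r"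
  obtains R where "1 \<le> R" "\<And>x y. x \<in> \<Omega> \<Longrightarrow> y \<in> \<Omega> \<Longrightarrow> norm (x - y) \<le> R"
    "\<And>x. x \<in> \<Omega> \<Longrightarrow> bdist \<Omega> x \<le> R"
proof -
  have "bounded (closure \<Omega>)"
    using assms by (simp add: smoothly_bounded_domain_def bounded_closure)
  then obtain b where b: "0 < b" "\<And>x. x \<in> closure \<Omega> \<Longrightarrow> norm x \<le> b"
    using bounded_pos by blast
  obtain p where p: "p \<in> frontier \<Omega>"
    using frontier_nonempty [OF assms] by blast
  have diff: "norm (x - y) \<le> 2 * b + 1" if "x \<in> closure \<Omega>" "y \<in> closure \<Omega>" for x y
    using b(2) [OF that(1)] b(2) [OF that(2)] norm_triangle_ineq4 [of x y] by linarith
  show thesis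
  proof (rule that [of "2 * b + 1"])
    fix x assume "x \<in> \<Omega>"
    then show "bdist \<Omega> x \<le> 2 * b + 1"
      using diff [of x p] p infdist_le [OF p, of x] closure_subset
      by (force simp: bdist_def dist_norm frontier_def)
  qed (use b(1) diff closure_subset in auto)
qed

section \<open>Calibration by the truncated logarithm\<close>

context
  fixes \<Omega> :: "(complex^2) set" and r :: "complex^2 \<Rightarrow> real"
    and K :: "complex^2 \<Rightarrow> complex^2 \<Rightarrow> real" and m :: nat and \<epsilon> C :: real
  assumes dom: "smoothly_bounded_domain \<Omega> r"
    and finsler: "finsler_metric \<Omega> K"
    and nonneg: "\<forall>z\<in>\<Omega>. \<forall>X. 0 \<le> K z X"
    and m: "1 \<le> m" and \<epsilon>: "0 < \<epsilon>" and C: "0 < C"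
    and unique: "\<And>z. z \<in> collar \<Omega> \<epsilon> \<Longrightarrow> \<exists>!p. is_nearest \<Omega> z p"
    and lower: "\<And>z X. z \<in> collar \<Omega> \<epsilon> \<Longrightarrow> norm (N_part \<Omega> r z X) / bdist \<Omega> z
             + 1 / C * (norm (H_part \<Omega> r z X) / bdist \<Omega> z powr (1 / real m)) \<le> K z X"
begin

text \<open>One coefficient for both components: \<open>1 / C\<close> is what the metric grants
  horizontally, 1 is what the truncation leaves over normally.\<close>

definition horiz_weight :: "real \<Rightarrow> real" where
  "horiz_weight h = min 1 (1 / C) / h powr (1 / real m)"

lemma metric_lower_bound:
  assumes z: "z \<in> \<Omega>" and h: "bdist \<Omega> z \<le> h" "h < \<epsilon>" "h \<le> 1"
  shows "(1 / bdist \<Omega> z - 1 / h) * \<bar>inward_normal r (proj \<Omega> z) \<bullet> X\<bar> + horiz_weight h * norm X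
    \<le> K z X"
proof -
  let ?d = "bdist \<Omega> z" and ?N = "norm (N_part \<Omega> r z X)" and ?H = "norm (H_part \<Omega> r z X)"
  let ?q = "h powr (1 / real m)" and ?k = "min 1 (1 / C)"
  have zc: "z \<in> collar \<Omega> \<epsilon>"
    using assms by (simp add: collar_def)
  have d: "0 < ?d" "0 < h" "0 < ?q"
    using bdist_pos [OF dom z] h by auto
  have "h powr 1 \<le> ?q"
    using m d h by (intro powr_mono') auto
  then have hq: "h \<le> ?q"
    using d by simp
  have dq: "?d powr (1 / real m) \<le> ?q"
    using d h by (intro powr_mono2) auto
  have k: "0 \<le> ?k" "?k \<le> 1" "?k \<le> 1 / C"
    using C by auto
  have "?k / ?q * ?N \<le> 1 / h * ?N"
    using k hq d by (intro mult_right_mono frac_le) auto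
  moreover have "?k / ?q * ?H \<le> (1 / C) / (?d powr (1 / real m)) * ?H"
    using k dq d by (intro mult_right_mono frac_le) auto
  moreover have "?k / ?q * norm X \<le> ?k / ?q * (?H + ?N)"
    using norm_parts_bounds(3) [OF dom z unique [OF zc]] k d by (intro mult_left_mono) auto
  moreover have "(1 / ?d - 1 / h) * \<bar>inward_normal r (proj \<Omega> z) \<bullet> X\<bar> \<le> (1 / ?d - 1 / h) * ?N"
    using abs_inner_inward_normal_le [OF dom z unique [OF zc]] d h
    by (intro mult_left_mono) (auto simp: frac_le)
  ultimately have "(1 / ?d - 1 / h) * \<bar>inward_normal r (proj \<Omega> z) \<bullet> X\<bar> + ?k / ?q * norm X
      \<le> ?N / ?d + 1 / C * (?H / ?d powr (1 / real m))"
    by (simp add: algebra_simps)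
  also have "\<dots> \<le> K z X"
    using lower [OF zc] .
  finally show ?thesis
    by (simp add: horiz_weight_def)
qed

definition dtrunc :: "real \<Rightarrow> complex^2 \<Rightarrow> complex^2 \<Rightarrow> real" where
  "dtrunc h z X = (if bdist \<Omega> z \<le> h
     then (1 / bdist \<Omega> z - 1 / h) * (inward_normal r (proj \<Omega> z) \<bullet> X) else 0)"

text \<open>Up to height \<open>h\<close>, inside the collar, this is the chain rule. Above
  \<open>h\<close> the function is locally constant, so differentiability of the distance is not at
  issue there.\<close>

lemma trunc_bdist_has_derivative:
  assumes z: "z \<in> \<Omega>" and h: "0 < h" "h < \<epsilon>"
  shows "((\<lambda>w. trunc_ln h (bdist \<Omega> w)) has_derivative dtrunc h z) (at z)"
proof (cases "bdist \<Omega> z \<le> h")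
  case True
  have zc: "z \<in> collar \<Omega> \<epsilon>"
    using True h z by (simp add: collar_def)
  have "(trunc_ln h has_derivative (\<lambda>t. (1 / bdist \<Omega> z - 1 / h) * t)) (at (bdist \<Omega> z))"
    using trunc_ln_has_derivative [OF h(1) bdist_pos [OF dom z]] True
    by (simp add: has_field_derivative_def)
  from has_derivative_compose [OF bdist_has_derivative [OF dom z unique [OF zc]] this]
  show ?thesis
    using True by (simp add: dtrunc_def [abs_def])
next
  case False
  have "isCont (bdist \<Omega>) z"
    using bdist_continuous [of UNIV] by (simp add: continuous_on_eq_continuous_at)
  then have "\<forall>\<^sub>F w in nhds z. h < bdist \<Omega> w"
    using False by (auto simp: isCont_def tendsto_at_iff_tendsto_nhds intro: order_tendstoD)
  then obtain U where U: "open U" "z \<in> U" "\<And>w. w \<in> U \<Longrightarrow> h < bdist \<Omega> w"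
    by (auto simp: eventually_nhds)
  have "((\<lambda>_. ln h - 1) has_derivative (\<lambda>_. 0)) (at z)"
    by simp
  then have "((\<lambda>w. trunc_ln h (bdist \<Omega> w)) has_derivative (\<lambda>_. 0)) (at z)"
    by (rule has_derivative_transform_within_open [OF _ U(1,2)])
      (use U(3) h in \<open>simp add: trunc_ln_top less_imp_le\<close>)
  then show ?thesis
    using False by (simp add: dtrunc_def [abs_def])
qed

text \<open>Above \<open>h\<close> the differential vanishes and \<open>K\<close> is nonnegative, so
  the first claim also covers curves that leave the collar.\<close>

lemma abs_dtrunc_le:
  assumes "z \<in> \<Omega>" "0 < h" "h < \<epsilon>" "h \<le> 1"
  shows "\<bar>dtrunc h z X\<bar> \<le> K z X"
    and "bdist \<Omega> z \<le> h \<Longrightarrow> \<bar>dtrunc h z X\<bar> + horiz_weight h * norm X \<le> K z X"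
proof -
  have w: "0 \<le> horiz_weight h"
    using C by (simp add: horiz_weight_def)
  have *: "\<bar>dtrunc h z X\<bar> + horiz_weight h * norm X \<le> K z X" if d: "bdist \<Omega> z \<le> h"
  proof -
    have "0 \<le> 1 / bdist \<Omega> z - 1 / h"
      using bdist_pos [OF dom assms(1)] d by (simp add: frac_le)
    then show ?thesis
      using metric_lower_bound [OF assms(1) d assms(3,4), of X] d
      by (simp add: dtrunc_def abs_mult)
  qed
  then show "bdist \<Omega> z \<le> h \<Longrightarrow> \<bar>dtrunc h z X\<bar> + horiz_weight h * norm X \<le> K z X" .
  show "\<bar>dtrunc h z X\<bar> \<le> K z X"
  proof (cases "bdist \<Omega> z \<le> h")
    case True
    have "\<bar>dtrunc h z X\<bar> \<le> \<bar>dtrunc h z X\<bar> + horiz_weight h * norm X"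
      using w by simp
    also have "\<dots> \<le> K z X"
      using * [OF True] .
    finally show ?thesis .
  qed (use nonneg assms(1) in \<open>simp add: dtrunc_def\<close>)
qed

text \<open>The test function is plus or minus the truncated logarithm plus \<open>c\<close> times
  the coordinate along the chord, so a single calibration captures height change and displacement
  together.\<close>

lemma curve_length_ge_height:
  assumes "piecewise_C1 \<gamma> a b" "\<gamma> ` {a..b} \<subseteq> \<Omega>" "a \<le> u" "u \<le> v" "v \<le> b"
    and h: "0 < h" "h < \<epsilon>"
    and le: "\<And>t X. t \<in> {u..v} \<Longrightarrow> \<bar>dtrunc h (\<gamma> t) X\<bar> + c * norm X \<le> K (\<gamma> t) X" and "0 \<le> c"
  shows "\<bar>trunc_ln h (bdist \<Omega> (\<gamma> v)) - trunc_ln h (bdist \<Omega> (\<gamma> u))\<bar> + c * norm (\<gamma> v - \<gamma> u)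
    \<le> curve_length K \<gamma> u v"
proof -
  define e where "e = sgn (\<gamma> v - \<gamma> u)"
  have e: "e \<bullet> (\<gamma> v - \<gamma> u) = norm (\<gamma> v - \<gamma> u)" "norm e \<le> 1"
    by (cases "\<gamma> v = \<gamma> u"; simp add: e_def sgn_div_norm power2_eq_square flip: power2_norm_eq_inner)+
  have main: "\<sigma> * (trunc_ln h (bdist \<Omega> (\<gamma> v)) - trunc_ln h (bdist \<Omega> (\<gamma> u))) + c * norm (\<gamma> v - \<gamma> u)
      \<le> curve_length K \<gamma> u v" if \<sigma>: "\<bar>\<sigma>\<bar> = 1" for \<sigma> :: real
  proof -
    define f where "f z = \<sigma> * trunc_ln h (bdist \<Omega> z) + c * (e \<bullet> z)" for z
    define f' where "f' z X = \<sigma> * dtrunc h z X + c * (e \<bullet> X)" for z X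
    have "f (\<gamma> v) - f (\<gamma> u) \<le> curve_length K \<gamma> u v"
    proof (rule curve_length_lower_bound [OF finsler open_domain [OF dom] nonneg assms(1-5), of f f'])
      fix t X assume t: "t \<in> {u..v}"
      then have "\<gamma> t \<in> \<Omega>"
        using assms(2,3,5) by auto
      then have "((\<lambda>w. trunc_ln h (bdist \<Omega> w)) has_derivative dtrunc h (\<gamma> t)) (at (\<gamma> t))"
        using trunc_bdist_has_derivative h by blast
      then show "(f has_derivative f' (\<gamma> t)) (at (\<gamma> t))"
        unfolding f_def [abs_def] f'_def [abs_def]
        by (auto intro!: derivative_eq_intros)
      have "\<sigma> * dtrunc h (\<gamma> t) X \<le> \<bar>dtrunc h (\<gamma> t) X\<bar>"
        using \<sigma> by (metis abs_ge_self abs_mult mult_1)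
      moreover have "e \<bullet> X \<le> norm X"
        using norm_cauchy_schwarz [of e X] e(2) mult_right_mono [of "norm e" 1 "norm X"] by simp
      then have "c * (e \<bullet> X) \<le> c * norm X"
        using \<open>0 \<le> c\<close> by (rule mult_left_mono)
      ultimately show "f' (\<gamma> t) X \<le> K (\<gamma> t) X"
        using le [OF t, of X] by (simp add: f'_def)
    qed
    moreover have "f (\<gamma> v) - f (\<gamma> u)
        = \<sigma> * (trunc_ln h (bdist \<Omega> (\<gamma> v)) - trunc_ln h (bdist \<Omega> (\<gamma> u))) + c * (e \<bullet> (\<gamma> v - \<gamma> u))"
      by (simp add: f_def algebra_simps inner_diff_right)
    ultimately show ?thesis
      by (simp add: e(1))
  qed
  from main [of 1] main [of "-1"] show ?thesis
    by (auto simp: abs_if algebra_simps)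
qed

lemma finsler_dist_lower_bound:
  "\<exists>C'. \<forall>x\<in>\<Omega>. \<forall>y\<in>\<Omega>. g_fn \<Omega> m x y - C' \<le> finsler_dist \<Omega> K x y"
proof -
  \<comment> \<open>Strictly below \<open>\<epsilon>\<close> to stay in the collar, and at most 1
    for comparing powers of heights.\<close>
  define h0 where "h0 = min 1 (\<epsilon> / 2)"
  have h0: "0 < h0" "h0 < \<epsilon>" "h0 \<le> 1"
    using \<epsilon> by (auto simp: h0_def)
  define k where "k = min 1 (1 / C)"
  have k: "0 < k"
    using C by (simp add: k_def)
  obtain c where c: "\<And>A. 0 \<le> A \<Longrightarrow> 2 * ln (1 + A ^ m) \<le> k * A + c"
    using ln_one_plus_power_le_linear [OF k m] by blast
  obtain R where R: "1 \<le> R" "\<And>x y. x \<in> \<Omega> \<Longrightarrow> y \<in> \<Omega> \<Longrightarrow> norm (x - y) \<le> R"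
    "\<And>x. x \<in> \<Omega> \<Longrightarrow> bdist \<Omega> x \<le> R"
    using bounded_domain_bounds [OF dom] by blast
  \<comment> \<open>First entry: curves of maximal height at most \<open>h0\<close>. Second: higher
    curves, for which the numerator of \<open>g_fn\<close> is estimated by \<open>R ^ m + R\<close>.
    The summand 2 is the loss in the two values \<open>ln h - 1\<close> at the top.\<close>
  define C' where "C' = max (c + 2) (2 * ln (R ^ m + R) - 2 * ln h0 + 2)"
  have "g_fn \<Omega> m x y - C' \<le> finsler_dist \<Omega> K x y" if xy: "x \<in> \<Omega>" "y \<in> \<Omega>" for x y
  proof -
    obtain c0 where c0: "joinable \<Omega> K x y c0"
      using joinable_exists [OF finsler open_domain [OF dom] nonneg connected_domain [OF dom] xy] by blast
    show ?thesis
    proof (rule finsler_dist_ge [OF finsler open_domain [OF dom] nonneg c0])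
      fix \<gamma> :: "real \<Rightarrow> complex^2"
      assume \<gamma>: "piecewise_C1 \<gamma> 0 1" "\<gamma> ` {0..1} \<subseteq> \<Omega>" "\<gamma> 0 = x" "\<gamma> 1 = y"
      let ?\<delta> = "bdist \<Omega>"
      have pos: "0 < ?\<delta> x" "0 < ?\<delta> y"
        using bdist_pos [OF dom] xy by auto
      have "continuous_on {0..1} \<gamma>"
        by (rule piecewise_C1_regularity [OF \<gamma>(1)])
      then have "continuous_on {0..1} (\<lambda>t. ?\<delta> (\<gamma> t))"
        by (rule continuous_on_compose2 [OF bdist_continuous [of UNIV]]) auto
      then obtain t0 where t0: "t0 \<in> {0..1}" "\<And>t. t \<in> {0..1} \<Longrightarrow> ?\<delta> (\<gamma> t) \<le> ?\<delta> (\<gamma> t0)"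
        using continuous_attains_sup [of "{0..1}" "\<lambda>t. ?\<delta> (\<gamma> t)"] by auto
      define H where "H = ?\<delta> (\<gamma> t0)"
      have H: "?\<delta> x \<le> H" "?\<delta> y \<le> H" "0 < H"
        using t0(2) [of 0] t0(2) [of 1] \<gamma>(3,4) pos by (auto simp: H_def)
      let ?N = "norm (x - y) ^ m + max (?\<delta> x) (?\<delta> y)"
      have N: "0 < ?N"
        using pos by (intro add_nonneg_pos) auto
      have split: "curve_length K \<gamma> 0 1 = curve_length K \<gamma> 0 t0 + curve_length K \<gamma> t0 1"
        using curve_length_combine [OF finsler open_domain [OF dom] nonneg \<gamma>(1,2)] t0(1) by auto
      have inside: "\<gamma> t \<in> \<Omega>" if "t \<in> {0..1}" for t
        using \<gamma>(2) that by blast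
      \<comment> \<open>Applied below with \<open>H\<close> and \<open>horiz_weight H\<close> for
        low curves, and with \<open>h0\<close> and weight 0 for curves climbing above
        \<open>h0\<close>.\<close>
      have two_sided: "2 * ln h - 2 - ln (?\<delta> x) - ln (?\<delta> y)
          + w * (norm (\<gamma> t0 - x) + norm (y - \<gamma> t0)) \<le> curve_length K \<gamma> 0 1"
        if h: "0 < h" "h < \<epsilon>" "h \<le> H" and w: "0 \<le> w"
          and le: "\<And>t X. t \<in> {0..1} \<Longrightarrow> \<bar>dtrunc h (\<gamma> t) X\<bar> + w * norm X \<le> K (\<gamma> t) X" for h w
      proof -
        have "\<bar>trunc_ln h (?\<delta> (\<gamma> t0)) - trunc_ln h (?\<delta> (\<gamma> 0))\<bar> + w * norm (\<gamma> t0 - \<gamma> 0)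
            \<le> curve_length K \<gamma> 0 t0"
          by (rule curve_length_ge_height [OF \<gamma>(1,2) _ _ _ h(1,2) le w]) (use t0(1) in auto)
        moreover have "\<bar>trunc_ln h (?\<delta> (\<gamma> 1)) - trunc_ln h (?\<delta> (\<gamma> t0))\<bar> + w * norm (\<gamma> 1 - \<gamma> t0)
            \<le> curve_length K \<gamma> t0 1"
          by (rule curve_length_ge_height [OF \<gamma>(1,2) _ _ _ h(1,2) le w]) (use t0(1) in auto)
        moreover have "trunc_ln h (?\<delta> (\<gamma> t0)) = ln h - 1"
          using h by (simp add: trunc_ln_top H_def)
        moreover have "trunc_ln h (?\<delta> x) \<le> ln (?\<delta> x)" "trunc_ln h (?\<delta> y) \<le> ln (?\<delta> y)"
          using h pos by (auto intro: trunc_ln_le_ln)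
        ultimately show ?thesis
          unfolding split using \<gamma>(3,4) by (simp add: distrib_left)
      qed
      show "g_fn \<Omega> m x y - C' \<le> curve_length K \<gamma> 0 1"
      proof (cases "H \<le> h0")
        case True
        define q where "q = H powr (1 / real m)"
        have q: "0 < q" "q ^ m = H"
          using H m by (simp_all add: q_def powr_powr flip: powr_realpow)
        \<comment> \<open>In units of \<open>q\<close> the displacement is \<open>A\<close>, and the
          numerator of \<open>g_fn\<close> is at most \<open>H * (1 + A ^ m)\<close>.\<close>
        define A where "A = norm (x - y) / q"
        have A: "0 \<le> A" "norm (x - y) ^ m = H * A ^ m"
          using q H by (simp_all add: A_def power_divide)
        have hw: "horiz_weight H = k / q"
          by (simp add: horiz_weight_def k_def q_def)
        have "2 * ln H - 2 - ln (?\<delta> x) - ln (?\<delta> y)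
          + horiz_weight H * (norm (\<gamma> t0 - x) + norm (y - \<gamma> t0)) \<le> curve_length K \<gamma> 0 1"
        proof (rule two_sided)
          fix t :: real and X assume t: "t \<in> {0..1}"
          show "\<bar>dtrunc H (\<gamma> t) X\<bar> + horiz_weight H * norm X \<le> K (\<gamma> t) X"
            using abs_dtrunc_le(2) [OF inside [OF t], of H X] t0(2) [OF t] H True h0
            by (simp add: H_def)
        qed (use H True h0 k q hw in auto)
        moreover have "norm (x - y) \<le> norm (\<gamma> t0 - x) + norm (y - \<gamma> t0)"
          using norm_triangle_ineq [of "x - \<gamma> t0" "\<gamma> t0 - y"] by (simp add: norm_minus_commute)
        then have "k / q * norm (x - y) \<le> horiz_weight H * (norm (\<gamma> t0 - x) + norm (y - \<gamma> t0))"
          unfolding hw using k q by (intro mult_left_mono) auto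
        moreover have "k / q * norm (x - y) = k * A"
          by (simp add: A_def)
        moreover have "ln ?N \<le> ln H + ln (1 + A ^ m)"
        proof -
          have "?N \<le> H * (1 + A ^ m)"
            using A H by (simp add: algebra_simps)
          then have "ln ?N \<le> ln (H * (1 + A ^ m))"
            using N by (intro ln_mono)
          also have "\<dots> = ln H + ln (1 + A ^ m)"
            using H A by (intro ln_mult_pos) (auto intro: add_pos_nonneg)
          finally show ?thesis .
        qed
        ultimately show ?thesis
          using c [OF A(1)] unfolding g_fn_eq [OF pos] C'_def by linarith
      next
        case False
        have "2 * ln h0 - 2 - ln (?\<delta> x) - ln (?\<delta> y)
          + 0 * (norm (\<gamma> t0 - x) + norm (y - \<gamma> t0)) \<le> curve_length K \<gamma> 0 1"
          by (rule two_sided) (use False h0 abs_dtrunc_le(1) [OF inside] in auto)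
        moreover have "ln ?N \<le> ln (R ^ m + R)"
          using N R(2) [OF xy] R(3) xy by (intro ln_mono add_mono power_mono) auto
        ultimately show ?thesis
          unfolding g_fn_eq [OF pos] C'_def by linarith
      qed
    qed
  qed
  then show ?thesis by blast
qed

end

section \<open>Upper bound\<close>

context
  fixes \<Omega> :: "(complex^2) set" and r :: "complex^2 \<Rightarrow> real"
    and K :: "complex^2 \<Rightarrow> complex^2 \<Rightarrow> real" and \<epsilon> C :: real
  assumes dom: "smoothly_bounded_domain \<Omega> r"
    and finsler: "finsler_metric \<Omega> K"
    and nonneg: "\<forall>z\<in>\<Omega>. \<forall>X. 0 \<le> K z X"
    and \<epsilon>: "0 < \<epsilon>" and C: "0 < C"
    and unique: "\<And>z. z \<in> collar \<Omega> \<epsilon> \<Longrightarrow> \<exists>!p. is_nearest \<Omega> z p"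
    and upper: "\<And>z X. z \<in> collar \<Omega> \<epsilon> \<Longrightarrow> K z X \<le> norm (N_part \<Omega> r z X) / bdist \<Omega> z
             + C * (norm (H_part \<Omega> r z X) / bdist \<Omega> z powr (1 / 2))"
begin

text \<open>A height at most 1 is below its square root, so the horizontal term is also controlled
  by the inverse height. This crude bound suffices for the short segment at the top.\<close>

lemma metric_upper_bound:
  assumes z: "z \<in> \<Omega>" and d: "bdist \<Omega> z < \<epsilon>" "bdist \<Omega> z \<le> 1"
  shows "K z X \<le> (1 + C) * norm X / bdist \<Omega> z"
proof -
  let ?d = "bdist \<Omega> z"
  have zc: "z \<in> collar \<Omega> \<epsilon>"
    using z d by (simp add: collar_def)
  have pos: "0 < ?d"
    using bdist_pos [OF dom z] .
  have "?d powr 1 \<le> ?d powr (1 / 2)"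
    using d pos by (intro powr_mono') auto
  then have root: "?d \<le> ?d powr (1 / 2)"
    using pos by simp
  have "norm (N_part \<Omega> r z X) / ?d \<le> norm X / ?d"
    using norm_parts_bounds(2) [OF dom z unique [OF zc]] pos by (simp add: divide_right_mono)
  moreover have "norm (H_part \<Omega> r z X) / ?d powr (1 / 2) \<le> norm X / ?d"
    using norm_parts_bounds(1) [OF dom z unique [OF zc]] pos root by (intro frac_le) auto
  then have "C * (norm (H_part \<Omega> r z X) / ?d powr (1 / 2)) \<le> C * (norm X / ?d)"
    using C by (intro mult_left_mono) auto
  ultimately have "K z X \<le> norm X / ?d + C * (norm X / ?d)"
    using upper [OF zc, of X] by linarith
  then show ?thesis
    by (simp add: distrib_right add_divide_distrib)
qed

text \<open>On the normal the height equals the parameter and velocities have no horizontal part, so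
  integrating the inverse height gives the logarithm with constant one.\<close>

lemma joinable_along_normal:
  assumes ball: "\<And>s. 0 < s \<Longrightarrow> s < s0 \<Longrightarrow>
      p + s *\<^sub>R inward_normal r p \<in> \<Omega> \<and> bdist \<Omega> (p + s *\<^sub>R inward_normal r p) = s"
    and p: "p \<in> frontier \<Omega>" and s0: "s0 \<le> \<epsilon>"
    and a: "0 < a" "a < s0" and b: "0 < b" "b < s0"
  shows "joinable \<Omega> K (p + a *\<^sub>R inward_normal r p) (p + b *\<^sub>R inward_normal r p) \<bar>ln b - ln a\<bar>"
proof -
  define n where "n = inward_normal r p"
  define q where "q t = a + t * (b - a)" for t
  have n: "norm n = 1"
    using norm_inward_normal [OF dom p] by (simp add: n_def)
  have q: "0 < q t" "q t < s0" if "t \<in> {0..1}" for t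
  proof -
    have "q t = (1 - t) * a + t * b"
      by (simp add: q_def algebra_simps)
    moreover have "min a b \<le> (1 - t) * a + t * b" "(1 - t) * a + t * b \<le> max a b"
      using that convex_bound_le [of a "max a b" b "1 - t" t]
        convex_bound_le [of "- a" "- min a b" "- b" "1 - t" t] by auto
    ultimately show "0 < q t" "q t < s0"
      using a b by auto
  qed
  have z: "p + q t *\<^sub>R n \<in> \<Omega>" "bdist \<Omega> (p + q t *\<^sub>R n) = q t"
    "K (p + q t *\<^sub>R n) (c *\<^sub>R n) \<le> \<bar>c\<bar> / q t" if t: "t \<in> {0..1}" for t c
  proof -
    let ?z = "p + q t *\<^sub>R n"
    show zO: "?z \<in> \<Omega>" and d: "bdist \<Omega> ?z = q t"
      using ball [of "q t"] q [OF t] by (auto simp: n_def)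
    have zc: "?z \<in> collar \<Omega> \<epsilon>"
      using zO d q [OF t] s0 by (simp add: collar_def)
    have "is_nearest \<Omega> ?z p"
      using p d q [OF t] n by (simp add: is_nearest_def dist_norm)
    then have proj: "proj \<Omega> ?z = p"
      by (rule proj_eq [OF dom zO unique [OF zc]])
    have "H_part \<Omega> r ?z (c *\<^sub>R n) = 0"
      using H_part_inward_normal [OF dom zO unique [OF zc], of c] unfolding proj
      by (simp only: n_def)
    then show "K ?z (c *\<^sub>R n) \<le> \<bar>c\<bar> / q t"
      using upper [OF zc, of "c *\<^sub>R n"] n d by (simp add: N_part_def)
  qed
  have seg: "p + a *\<^sub>R n + t *\<^sub>R (p + b *\<^sub>R n - (p + a *\<^sub>R n)) = p + q t *\<^sub>R n" for t
    by (simp add: q_def algebra_simps)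
  have "joinable \<Omega> K (p + a *\<^sub>R n) (p + b *\<^sub>R n) \<bar>ln b - ln a\<bar>"
  proof (rule joinable_segment [OF finsler open_domain [OF dom] nonneg, where g = "\<lambda>t. \<bar>b - a\<bar> / q t"])
    show "closed_segment (p + a *\<^sub>R n) (p + b *\<^sub>R n) \<subseteq> \<Omega>"
    proof
      fix w assume "w \<in> closed_segment (p + a *\<^sub>R n) (p + b *\<^sub>R n)"
      then obtain t where "t \<in> {0..1}" "w = p + q t *\<^sub>R n"
        by (auto simp: in_segment q_def algebra_simps)
      then show "w \<in> \<Omega>"
        using z(1) by simp
    qed
  next
    fix t :: real assume t: "t \<in> {0..1}"
    have "p + b *\<^sub>R n - (p + a *\<^sub>R n) = (b - a) *\<^sub>R n"
      by (simp add: algebra_simps)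
    then show "K (p + a *\<^sub>R n + t *\<^sub>R (p + b *\<^sub>R n - (p + a *\<^sub>R n))) (p + b *\<^sub>R n - (p + a *\<^sub>R n))
        \<le> \<bar>b - a\<bar> / q t"
      unfolding seg using z(3) [OF t, of "b - a"] by simp
  next
    \<comment> \<open>The factor \<open>sgn (b - a)\<close> treats climbing and descending at
      once.\<close>
    have "((\<lambda>t. \<bar>b - a\<bar> / q t) has_integral
        sgn (b - a) * ln (q 1) - sgn (b - a) * ln (q 0)) {0..1}"
    proof (rule fundamental_theorem_of_calculus)
      fix t :: real assume t: "t \<in> {0..1}"
      have "((\<lambda>t. sgn (b - a) * ln (q t)) has_real_derivative sgn (b - a) * ((b - a) / q t))
          (at t within {0..1})"
        using q(1) [OF t] unfolding q_def by (auto intro!: derivative_eq_intros)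
      then show "((\<lambda>t. sgn (b - a) * ln (q t)) has_vector_derivative \<bar>b - a\<bar> / q t)
          (at t within {0..1})"
        by (simp add: has_real_derivative_iff_has_vector_derivative abs_sgn mult.commute)
    qed simp
    moreover have "sgn (b - a) * ln (q 1) - sgn (b - a) * ln (q 0) = \<bar>ln b - ln a\<bar>"
      using a b by (simp add: q_def sgn_if abs_if)
    ultimately show "((\<lambda>t. \<bar>b - a\<bar> / q t) has_integral \<bar>ln b - ln a\<bar>) {0..1}"
      by simp
  qed
  then show ?thesis
    by (simp add: n_def)
qed

lemma nearest_point_representation:
  assumes z: "z \<in> \<Omega>" "bdist \<Omega> z < \<epsilon>"
  obtains p where "p \<in> frontier \<Omega>" "z = p + bdist \<Omega> z *\<^sub>R inward_normal r p"
proof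
  let ?p = "proj \<Omega> z"
  have zc: "z \<in> collar \<Omega> \<epsilon>"
    using z by (simp add: collar_def)
  have near: "is_nearest \<Omega> z ?p"
    using proj_nearest [OF dom z(1) unique [OF zc]] .
  then show "?p \<in> frontier \<Omega>"
    by (simp add: is_nearest_def)
  have "z - ?p = norm (z - ?p) *\<^sub>R sgn (z - ?p)"
    by (cases "z = ?p") (simp_all add: sgn_div_norm)
  then have "z - ?p = bdist \<Omega> z *\<^sub>R inward_normal r ?p"
    using near nearest_point_normal [OF dom z(1) near] by (simp add: is_nearest_def dist_norm)
  then show "z = ?p + bdist \<Omega> z *\<^sub>R inward_normal r ?p"
    by (simp add: algebra_simps)
qed

text \<open>Points of the closure at positive distance from the frontier lie in
  \<open>\<Omega>\<close>, so the set is a closed part of the compact closure.\<close>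

lemma compact_superlevel:
  assumes "0 < s"
  shows "compact {z \<in> \<Omega>. s \<le> bdist \<Omega> z}"
proof -
  have "{z \<in> \<Omega>. s \<le> bdist \<Omega> z} = closure \<Omega> \<inter> {z. s \<le> bdist \<Omega> z}"
  proof (intro set_eqI iffI)
    fix z assume z: "z \<in> closure \<Omega> \<inter> {z. s \<le> bdist \<Omega> z}"
    then have "z \<notin> frontier \<Omega>"
      using assms by (auto simp: bdist_def)
    then show "z \<in> {z \<in> \<Omega>. s \<le> bdist \<Omega> z}"
      using z by (auto simp: frontier_def interior_open open_domain [OF dom])
  qed (use closure_subset in auto)
  moreover have "closed {z. s \<le> bdist \<Omega> z}"
    by (intro closed_Collect_le bdist_continuous continuous_on_const)
  moreover have "compact (closure \<Omega>)"
    using dom by (simp add: smoothly_bounded_domain_def compact_closure)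
  ultimately show ?thesis
    by (simp add: compact_Int_closed)
qed

text \<open>Close points are joined by climbing along the normals to height \<open>8h\<close>. There the end
  points are at distance at most \<open>5h\<close>, because the normals are uniformly continuous, so the
  segment between them stays at height at least \<open>3h\<close> and has bounded length.\<close>

lemma joinable_close_points:
  obtains s1 where "0 < s1"
    "\<And>x y h. x \<in> \<Omega> \<Longrightarrow> y \<in> \<Omega> \<Longrightarrow> bdist \<Omega> x \<le> h \<Longrightarrow> bdist \<Omega> y \<le> h \<Longrightarrow> norm (x - y) \<le> h \<Longrightarrow>
      h < s1 \<Longrightarrow> joinable \<Omega> K x y
        (2 * ln (8 * h) - ln (bdist \<Omega> x) - ln (bdist \<Omega> y) + 2 * (1 + C))"
    "\<And>x s. x \<in> \<Omega> \<Longrightarrow> bdist \<Omega> x \<le> s \<Longrightarrow> s < s1 \<Longrightarrow> \<exists>w\<in>\<Omega>. bdist \<Omega> w = s \<and>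
      joinable \<Omega> K x w (ln s - ln (bdist \<Omega> x)) \<and> joinable \<Omega> K w x (ln s - ln (bdist \<Omega> x))"
proof -
  obtain s0 where s0: "0 < s0" "\<And>p s. p \<in> frontier \<Omega> \<Longrightarrow> 0 < s \<Longrightarrow> s < s0 \<Longrightarrow>
      p + s *\<^sub>R inward_normal r p \<in> \<Omega> \<and> bdist \<Omega> (p + s *\<^sub>R inward_normal r p) = s"
    using uniform_interior_ball [OF dom] by blast
  \<comment> \<open>A change of normal by 1/4 moves a point at height \<open>8 * h\<close> by
    \<open>2 * h\<close>.\<close>
  obtain d where d: "0 < d" "\<And>p q. p \<in> frontier \<Omega> \<Longrightarrow> q \<in> frontier \<Omega> \<Longrightarrow> dist q p < d \<Longrightarrow>
      dist (inward_normal r q) (inward_normal r p) < 1 / 4"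
    using inward_normal_uniformly_continuous [OF dom] unfolding uniformly_continuous_on_def
    by (metis zero_less_divide_1_iff zero_less_numeral)
  define s2 where "s2 = min 1 (min s0 \<epsilon>)"
  have s2: "0 < s2" "s2 \<le> 1" "s2 \<le> s0" "s2 \<le> \<epsilon>"
    using s0 \<epsilon> by (auto simp: s2_def)
  have along: "joinable \<Omega> K (p + a *\<^sub>R inward_normal r p) (p + b *\<^sub>R inward_normal r p) \<bar>ln b - ln a\<bar>"
    if "p \<in> frontier \<Omega>" "0 < a" "a < s2" "0 < b" "b < s2" for p a b
    by (rule joinable_along_normal [of s2]) (use that s0 s2 in auto)
  \<comment> \<open>\<open>13 * h < s2\<close> covers the top segment, whose heights reach at most
    \<open>8 * h + 5 * h\<close>; \<open>3 * h < d\<close> lets the continuity of the normals apply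
    to the feet \<open>p\<close> and \<open>q\<close>.\<close>
  define s1 where "s1 = min (s2 / 13) (d / 3)"
  have s1: "0 < s1" "s1 \<le> s2 / 13" "s1 \<le> d / 3"
    using s2 d by (auto simp: s1_def)
  show thesis
  proof (rule that [OF s1(1)])
    fix x s assume x: "x \<in> \<Omega>" "bdist \<Omega> x \<le> s" "s < s1"
    have pos: "0 < bdist \<Omega> x"
      using bdist_pos [OF dom x(1)] .
    obtain p where p: "p \<in> frontier \<Omega>" "x = p + bdist \<Omega> x *\<^sub>R inward_normal r p"
      using nearest_point_representation [OF x(1)] x s1 s2 by force
    let ?w = "p + s *\<^sub>R inward_normal r p"
    have small: "0 < s" "s < s2" "bdist \<Omega> x < s2"
      using pos x s1 s2 by linarith+
    have "\<bar>ln s - ln (bdist \<Omega> x)\<bar> = ln s - ln (bdist \<Omega> x)" "\<bar>ln (bdist \<Omega> x) - ln s\<bar> = ln s - ln (bdist \<Omega> x)"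
      using x pos by auto
    then have "joinable \<Omega> K x ?w (ln s - ln (bdist \<Omega> x))" "joinable \<Omega> K ?w x (ln s - ln (bdist \<Omega> x))"
      using along [OF p(1) pos small(3,1,2)] along [OF p(1) small(1,2) pos small(3)] p(2) by metis+
    moreover have "?w \<in> \<Omega>" "bdist \<Omega> ?w = s"
      using s0(2) [OF p(1) small(1)] small s2 by auto
    ultimately show "\<exists>w\<in>\<Omega>. bdist \<Omega> w = s \<and>
      joinable \<Omega> K x w (ln s - ln (bdist \<Omega> x)) \<and> joinable \<Omega> K w x (ln s - ln (bdist \<Omega> x))"
      by blast
  next
    fix x y h
    assume x: "x \<in> \<Omega>" "bdist \<Omega> x \<le> h" and y: "y \<in> \<Omega>" "bdist \<Omega> y \<le> h"
      and xy: "norm (x - y) \<le> h" and h: "h < s1"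
    have pos: "0 < bdist \<Omega> x" "0 < bdist \<Omega> y"
      using bdist_pos [OF dom] x(1) y(1) by auto
    then have "0 < h"
      using x by linarith
    have small: "bdist \<Omega> x < s2" "bdist \<Omega> y < s2" "8 * h < s2" "0 < 8 * h" "13 * h < s2" "3 * h < d"
      using x y h s1 \<open>0 < h\<close> by linarith+
    obtain p where p: "p \<in> frontier \<Omega>" "x = p + bdist \<Omega> x *\<^sub>R inward_normal r p"
      using nearest_point_representation [OF x(1)] small s2 by force
    obtain q where q: "q \<in> frontier \<Omega>" "y = q + bdist \<Omega> y *\<^sub>R inward_normal r q"
      using nearest_point_representation [OF y(1)] small s2 by force
    define x' where "x' = p + (8 * h) *\<^sub>R inward_normal r p"
    define y' where "y' = q + (8 * h) *\<^sub>R inward_normal r q"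
    have x': "x' \<in> \<Omega>" "bdist \<Omega> x' = 8 * h"
      using s0(2) [OF p(1) small(4)] small s2 by (auto simp: x'_def)
    have "\<bar>ln (8 * h) - ln (bdist \<Omega> x)\<bar> = ln (8 * h) - ln (bdist \<Omega> x)"
      "\<bar>ln (bdist \<Omega> y) - ln (8 * h)\<bar> = ln (8 * h) - ln (bdist \<Omega> y)"
      using pos x y \<open>0 < h\<close> by auto
    then have up: "joinable \<Omega> K x x' (ln (8 * h) - ln (bdist \<Omega> x))"
      and down: "joinable \<Omega> K y' y (ln (8 * h) - ln (bdist \<Omega> y))"
      using along [OF p(1) pos(1) small(1,4,3)] along [OF q(1) small(4,3) pos(2) small(2)] p(2) q(2)
      unfolding x'_def y'_def by metis+
    \<comment> \<open>The feet are within \<open>h + h + h\<close> of each other, and the change of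
      normals adds at most \<open>2 * h\<close>.\<close>
    have dist_x': "norm (y' - x') \<le> 5 * h"
    proof -
      have "dist p x = bdist \<Omega> x" "dist y q = bdist \<Omega> y"
        using p q norm_inward_normal [OF dom] pos by (metis dist_commute dist_norm
            add_diff_cancel_left' abs_of_pos norm_scaleR mult.right_neutral)+
      moreover have "dist p q \<le> dist p x + dist x y + dist y q"
        using dist_triangle [of p q x] dist_triangle [of x q y] by linarith
      ultimately have pq: "dist q p \<le> 3 * h"
        using x y xy by (simp add: dist_norm norm_minus_commute)
      then have "dist (inward_normal r q) (inward_normal r p) < 1 / 4"
        using d(2) [OF p(1) q(1)] small by simp
      then have "8 * h * norm (inward_normal r q - inward_normal r p) \<le> 8 * h * (1 / 4)"
        using \<open>0 < h\<close> by (intro mult_left_mono) (auto simp: dist_norm)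
      moreover have "y' - x' = (q - p) + (8 * h) *\<^sub>R (inward_normal r q - inward_normal r p)"
        by (simp add: x'_def y'_def algebra_simps)
      then have "norm (y' - x') \<le> norm (q - p) + 8 * h * norm (inward_normal r q - inward_normal r p)"
        using norm_triangle_ineq [of "q - p" "(8 * h) *\<^sub>R (inward_normal r q - inward_normal r p)"] \<open>0 < h\<close>
        by simp
      ultimately show ?thesis
        using pq by (simp add: dist_norm)
    qed
    have "joinable \<Omega> K x' y' (2 * (1 + C))"
    proof (rule joinable_segment_const [OF finsler open_domain [OF dom] nonneg])
      have near: "dist x' w \<le> 5 * h" if "w \<in> closed_segment x' y'" for w
        using segment_bound(1) [OF that] dist_x' by (simp add: dist_norm norm_minus_commute)
      show sub: "closed_segment x' y' \<subseteq> \<Omega>"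
      proof
        fix w assume "w \<in> closed_segment x' y'"
        then have "w \<in> ball x' (bdist \<Omega> x')"
          using near \<open>0 < h\<close> x' by fastforce
        then show "w \<in> \<Omega>"
          using ball_bdist_subset [OF x'(1)] by blast
      qed
      fix w assume w: "w \<in> closed_segment x' y'"
      then have wO: "w \<in> \<Omega>"
        using sub by blast
      have "bdist \<Omega> x' \<le> bdist \<Omega> w + dist x' w" "bdist \<Omega> w \<le> bdist \<Omega> x' + dist w x'"
        unfolding bdist_def by (rule infdist_triangle)+
      then have bw: "3 * h \<le> bdist \<Omega> w" "bdist \<Omega> w \<le> 13 * h"
        using near [OF w] x' by (auto simp: dist_commute)
      have "K w (y' - x') \<le> (1 + C) * norm (y' - x') / bdist \<Omega> w"
        by (rule metric_upper_bound [OF wO]) (use bw small s2 in linarith)+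
      also have "\<dots> \<le> (1 + C) * (5 * h) / (3 * h)"
        using bw \<open>0 < h\<close> C dist_x' by (intro frac_le mult_left_mono) auto
      \<comment> \<open>The ratio 5/3 is rounded up to 2.\<close>
      also have "\<dots> \<le> 2 * (1 + C)"
        using \<open>0 < h\<close> C by simp
      finally show "K w (y' - x') \<le> 2 * (1 + C)" .
    qed
    from joinable_trans [OF finsler open_domain [OF dom] nonneg joinable_trans [OF finsler open_domain [OF dom] nonneg up this] down]
    show "joinable \<Omega> K x y (2 * ln (8 * h) - ln (bdist \<Omega> x) - ln (bdist \<Omega> y) + 2 * (1 + C))"
      by (rule joinable_mono) linarith
  qed
qed

text \<open>Pairs with small \<open>h\<close> are joined as close points. Otherwise both points are
  first taken into the compact set \<open>T\<close>, where one constant serves; \<open>ln h\<close>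
  is then bounded below, so an additive constant absorbs the cost.\<close>

lemma finsler_dist_upper_bound:
  "\<exists>C'. \<forall>x\<in>\<Omega>. \<forall>y\<in>\<Omega>. finsler_dist \<Omega> K x y \<le> g_fn \<Omega> 1 x y + C'"
proof -
  obtain s1 where s1: "0 < s1"
    and close: "\<And>x y h. x \<in> \<Omega> \<Longrightarrow> y \<in> \<Omega> \<Longrightarrow> bdist \<Omega> x \<le> h \<Longrightarrow> bdist \<Omega> y \<le> h \<Longrightarrow>
      norm (x - y) \<le> h \<Longrightarrow> h < s1 \<Longrightarrow> joinable \<Omega> K x y
        (2 * ln (8 * h) - ln (bdist \<Omega> x) - ln (bdist \<Omega> y) + 2 * (1 + C))"
    and climb: "\<And>x s. x \<in> \<Omega> \<Longrightarrow> bdist \<Omega> x \<le> s \<Longrightarrow> s < s1 \<Longrightarrow> \<exists>w\<in>\<Omega>. bdist \<Omega> w = s \<and>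
      joinable \<Omega> K x w (ln s - ln (bdist \<Omega> x)) \<and> joinable \<Omega> K w x (ln s - ln (bdist \<Omega> x))"
    using joinable_close_points by blast
  define s where "s = s1 / 2"
  have s: "0 < s" "s < s1"
    using s1 by (auto simp: s_def)
  define T where "T = {z \<in> \<Omega>. s \<le> bdist \<Omega> z}"
  have T: "compact T" "T \<subseteq> \<Omega>"
    using compact_superlevel [OF s(1)] by (auto simp: T_def)
  have "\<exists>B. \<forall>x\<in>T. \<forall>y\<in>T. joinable \<Omega> K x y B"
    by (rule uniformly_joinable_on_compact [OF finsler open_domain [OF dom] nonneg connected_domain [OF dom] T]) blast
  then obtain B where B: "\<And>x y. x \<in> T \<Longrightarrow> y \<in> T \<Longrightarrow> joinable \<Omega> K x y B"
    by blast
  obtain R where R: "1 \<le> R" "\<And>x. x \<in> \<Omega> \<Longrightarrow> bdist \<Omega> x \<le> R"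
    by (rule bounded_domain_bounds [OF dom]) (rule that)
  \<comment> \<open>Above both \<open>R\<close> and \<open>s\<close>, so
    \<open>ln R' - ln (bdist \<Omega> x)\<close> bounds the cost whether \<open>x\<close> already
    lies in \<open>T\<close> or climbs to height \<open>s\<close>.\<close>
  define R' where "R' = max R s"
  have to_T: "\<exists>w\<in>T. joinable \<Omega> K x w (ln R' - ln (bdist \<Omega> x)) \<and> joinable \<Omega> K w x (ln R' - ln (bdist \<Omega> x))"
    if x: "x \<in> \<Omega>" for x
  proof (cases "s \<le> bdist \<Omega> x")
    case True
    have "joinable \<Omega> K x x 0"
      using x finsler_zero [OF finsler open_domain [OF dom] nonneg x]
      by (intro joinable_segment_const [OF finsler open_domain [OF dom] nonneg]) auto
    moreover have "0 \<le> ln R' - ln (bdist \<Omega> x)"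
      using R(2) [OF x] bdist_pos [OF dom x] by (simp add: R'_def le_max_iff_disj)
    ultimately show ?thesis
      using True x by (intro bexI [of _ x]) (auto simp: T_def intro: joinable_mono)
  next
    case False
    then obtain w where w: "w \<in> \<Omega>" "bdist \<Omega> w = s" "joinable \<Omega> K x w (ln s - ln (bdist \<Omega> x))"
      "joinable \<Omega> K w x (ln s - ln (bdist \<Omega> x))"
      using climb [OF x _ s(2)] by auto
    have "ln s - ln (bdist \<Omega> x) \<le> ln R' - ln (bdist \<Omega> x)"
      using s(1) by (simp add: R'_def)
    then show ?thesis
      using w by (intro bexI [of _ w]) (auto simp: T_def intro: joinable_mono)
  qed
  \<comment> \<open>The term \<open>2 * ln 8\<close> is the price of climbing to
    \<open>8 * h\<close> instead of \<open>h\<close>.\<close>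
  define C' where "C' = max (2 * ln 8 + 2 * (1 + C)) (2 * ln R' + B - 2 * ln s1)"
  have "finsler_dist \<Omega> K x y \<le> g_fn \<Omega> 1 x y + C'" if x: "x \<in> \<Omega>" and y: "y \<in> \<Omega>" for x y
  proof -
    have pos: "0 < bdist \<Omega> x" "0 < bdist \<Omega> y"
      using bdist_pos [OF dom] x y by auto
    \<comment> \<open>The numerator of \<open>g_fn\<close> for exponent 1, and at the same time a
      scale admissible for \<open>close\<close>.\<close>
    define h where "h = norm (x - y) + max (bdist \<Omega> x) (bdist \<Omega> y)"
    have h: "0 < h" "bdist \<Omega> x \<le> h" "bdist \<Omega> y \<le> h" "norm (x - y) \<le> h"
      using pos by (auto simp: h_def intro: add_nonneg_pos add_increasing)
    have g: "g_fn \<Omega> 1 x y = 2 * ln h - ln (bdist \<Omega> x) - ln (bdist \<Omega> y)"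
      by (simp add: g_fn_eq [OF pos] h_def)
    show ?thesis
    proof (cases "h < s1")
      case True
      have "finsler_dist \<Omega> K x y
          \<le> 2 * ln (8 * h) - ln (bdist \<Omega> x) - ln (bdist \<Omega> y) + 2 * (1 + C)"
        by (rule finsler_dist_le [OF finsler open_domain [OF dom] nonneg close [OF x y h(2-4) True]])
      moreover have "ln (8 * h) = ln 8 + ln h"
        using h(1) by (intro ln_mult_pos) auto
      ultimately show ?thesis
        unfolding g C'_def by linarith
    next
      case False
      obtain u where u: "u \<in> T" "joinable \<Omega> K x u (ln R' - ln (bdist \<Omega> x))"
        using to_T [OF x] by blast
      obtain v where v: "v \<in> T" "joinable \<Omega> K v y (ln R' - ln (bdist \<Omega> y))"
        using to_T [OF y] by blast
      have "finsler_dist \<Omega> K x y \<le> ln R' - ln (bdist \<Omega> x) + B + (ln R' - ln (bdist \<Omega> y))"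
        by (intro finsler_dist_le [OF finsler open_domain [OF dom] nonneg]
            joinable_trans [OF finsler open_domain [OF dom] nonneg joinable_trans [OF finsler open_domain [OF dom] nonneg u(2) B [OF u(1) v(1)]] v(2)])
      moreover have "ln s1 \<le> ln h"
        using False s1 by simp
      ultimately show ?thesis
        unfolding g C'_def by linarith
    qed
  qed
  then show ?thesis by blast
qed

end

section \<open>Kobayashi metric and type\<close>

text \<open>All competitors are moduli, but \<open>Inf\<close> of the empty set is unspecified, so
  an admissible disc is exhibited: a small affine disc in direction \<open>v\<close>.\<close>

lemma kobayashi_nonneg:
  assumes "open \<Omega>" "z \<in> \<Omega>"
  shows "0 \<le> kobayashi \<Omega> z v"
  unfolding kobayashi_def
proof (rule cInf_greatest)
  obtain \<rho> where \<rho>: "0 < \<rho>" "ball z \<rho> \<subseteq> \<Omega>"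
    using assms openE by blast
  \<comment> \<open>The image of the disc stays within \<open>c * norm v < \<rho>\<close> of
    \<open>z\<close>; the added 1 covers \<open>v = 0\<close>. The matching \<open>\<zeta>\<close>
    is \<open>1 / c\<close>.\<close>
  define c where "c = \<rho> / (norm v + 1)"
  have "0 < norm v + 1"
    by (intro add_nonneg_pos) auto
  then have c: "0 < c" "c * norm v < \<rho>"
    using \<rho>(1) by (simp_all add: c_def pos_divide_less_eq distrib_left)
  define f where "f t = z + (t * complex_of_real c) *s v" for t
  have "f ` ball 0 1 \<subseteq> \<Omega>"
  proof
    fix w assume "w \<in> f ` ball 0 1"
    then obtain t where t: "cmod t < 1" "w = f t"
      by auto
    have "dist z w = cmod t * (c * norm v)"
      using c(1) by (simp add: t(2) f_def dist_norm norm_vec_def L2_set_def power_mult_distrib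
          norm_mult sum_distrib_left [symmetric] real_sqrt_mult)
    also have "\<dots> \<le> c * norm v"
      using t(1) c(1) by (intro mult_left_le_one_le) auto
    finally show "w \<in> \<Omega>"
      using c(2) \<rho>(2) by auto
  qed
  moreover have "deriv (\<lambda>t. f t $ k) 0 * (1 / complex_of_real c) = v $ k" for k
  proof -
    have "((\<lambda>t. f t $ k) has_field_derivative complex_of_real c * v $ k) (at 0)"
      unfolding f_def by (auto intro!: derivative_eq_intros)
    then show ?thesis
      using c(1) by (simp add: DERIV_imp_deriv)
  qed
  moreover have "holomorphic_map_on f (ball 0 1)"
    unfolding holomorphic_map_on_def f_def by (auto intro!: holomorphic_intros)
  moreover have "f 0 = z"
    by (simp add: f_def)
  ultimately show "{cmod \<zeta> |\<zeta> f. holomorphic_map_on f (ball 0 1) \<and> f ` ball 0 1 \<subseteq> \<Omega> \<and> f 0 = z \<and>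
      (\<forall>k. deriv (\<lambda>t. f t $ k) 0 * \<zeta> = v $ k)} \<noteq> {}"
    by blast
qed auto

text \<open>Tested on a complex line through \<open>p\<close>: the line itself has order 1, and
  \<open>r\<close> vanishes at \<open>p\<close>.\<close>

lemma dangelo_type_ge_1:
  assumes "r p = 0"
  shows "1 \<le> dangelo_type r p"
proof -
  define a :: "complex^2" where "a = axis 1 1"
  define \<gamma> where "\<gamma> t = p + t *s a" for t
  have a: "a \<noteq> 0"
    by (simp add: a_def axis_eq_0_iff)
  \<comment> \<open>For \<open>k = 1\<close> only the empty list is tested, that is, the value at
    0.\<close>
  have r_order: "1 \<le> vanishing_order (\<lambda>t. r (\<gamma> t)) 0"
    unfolding vanishing_order_def
    by (rule Sup_upper) (auto simp: \<gamma>_def assms one_enat_def intro!: exI [of _ 1])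
  have \<gamma>_order: "vanishing_order (\<lambda>t. \<gamma> t - p) 0 = 1"
  proof (rule antisym)
    have "((\<lambda>t. t *s a) has_derivative (\<lambda>t. t *s a)) (at 0)"
      by (rule bounded_linear_imp_has_derivative)
        (intro linear_conv_bounded_linear [THEN iffD1] linearI;
          simp add: vec_eq_iff algebra_simps)
    then have "frechet_derivative (\<lambda>t. t *s a) (at 0) = (\<lambda>t. t *s a)"
      by (rule frechet_derivative_at [symmetric])
    then have der: "iter_deriv [1] (\<lambda>t. \<gamma> t - p) 0 = a"
      by (simp add: \<gamma>_def)
    have "k \<le> 1" if "\<forall>vs. length vs < k \<longrightarrow> iter_deriv vs (\<lambda>t. \<gamma> t - p) 0 = 0" for k
    proof (rule ccontr)
      assume "\<not> k \<le> 1"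
      then have "iter_deriv [1] (\<lambda>t. \<gamma> t - p) 0 = 0"
        using that by (metis One_nat_def length_0_conv length_Cons not_le)
      then show False
        unfolding der using a by simp
    qed
    then show "vanishing_order (\<lambda>t. \<gamma> t - p) 0 \<le> 1"
      unfolding vanishing_order_def by (intro Sup_least) (auto simp: one_enat_def)
    show "1 \<le> vanishing_order (\<lambda>t. \<gamma> t - p) 0"
      unfolding vanishing_order_def
      by (rule Sup_upper) (auto simp: \<gamma>_def one_enat_def intro!: exI [of _ 1])
  qed
  have "ereal_of_enat 1 \<le> ereal_of_enat (vanishing_order (\<lambda>t. r (\<gamma> t)) 0)"
    using r_order by simp
  then have "1 \<le> ereal_of_enat (vanishing_order (\<lambda>t. r (\<gamma> t)) 0)
      / ereal_of_enat (vanishing_order (\<lambda>t. \<gamma> t - p) 0)"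
    by (simp add: \<gamma>_order one_ereal_def [symmetric] one_enat_def)
  also have "\<dots> \<le> dangelo_type r p"
    unfolding dangelo_type_def
  proof (rule Sup_upper, intro CollectI exI conjI)
    show "holomorphic_map_on \<gamma> (ball 0 1)"
      unfolding holomorphic_map_on_def \<gamma>_def by (auto intro!: holomorphic_intros)
    show "\<exists>t\<in>ball 0 1. \<gamma> t \<noteq> p"
      using a by (intro bexI [of _ "1/2"]) (auto simp: \<gamma>_def vec_eq_iff)
  qed (auto simp: \<gamma>_def)
  finally show ?thesis .
qed

text \<open>Supplies \<open>1 \<le> m\<close>, used when heights at most 1 are compared with their
  powers of exponent \<open>1 / real m\<close>.\<close>

lemma finite_type_ge_1:
  assumes "smoothly_bounded_domain \<Omega> r" "finite_type \<Omega> r m"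
  shows "1 \<le> m"
proof -
  obtain p where p: "p \<in> frontier \<Omega>"
    using frontier_nonempty [OF assms(1)] by blast
  moreover have "r p = 0"
    using p by (rule_tac defining_neighbourhood [OF assms(1)]) blast
  ultimately have "1 \<le> (SUP \<xi>\<in>frontier \<Omega>. dangelo_type r \<xi>)"
    using dangelo_type_ge_1 by (meson SUP_upper2)
  then show ?thesis
    using assms(2) by (simp add: finite_type_def one_ereal_def)
qed

theorem theorem1p12:
  fixes \<Omega> :: "(complex^2) set"
    and r :: "complex^2 \<Rightarrow> real"
    and m :: nat
    and K :: "complex^2 \<Rightarrow> complex^2 \<Rightarrow> real"
  assumes "smoothly_bounded_domain \<Omega> r"
    and "pseudoconvex \<Omega> r"
    and "finite_type \<Omega> r m"
    and "catlin_type_metric \<Omega> r m K"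
  shows "\<exists>C\<ge>1. \<forall>x\<in>\<Omega>. \<forall>y\<in>\<Omega>.
           g_fn \<Omega> m x y - C \<le> finsler_dist \<Omega> K x y \<and>
           finsler_dist \<Omega> K x y \<le> g_fn \<Omega> 1 x y + C"
proof -
  note dom = assms(1)
  have finsler: "finsler_metric \<Omega> K"
    using assms(4) by (simp add: catlin_type_metric_def)
  obtain S where S: "\<forall>z\<in>\<Omega>. \<forall>X. 0 < S z X \<and> K z X = kobayashi \<Omega> z X * S z X"
    using assms(4) unfolding catlin_type_metric_def by blast
  have nonneg: "\<forall>z\<in>\<Omega>. \<forall>X. 0 \<le> K z X"
    using S kobayashi_nonneg [OF open_domain [OF dom]] by (simp add: less_imp_le)
  obtain s \<xi> M A F U \<epsilon> C where cover: "catlin_cover \<Omega> r s \<xi> M A F U"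
    and \<epsilon>: "0 < \<epsilon>" "collar \<Omega> \<epsilon> \<subseteq> (\<Union>i<s. U i)" and C: "0 < C"
    and bounds: "\<forall>z\<in>collar \<Omega> \<epsilon>. \<forall>X.
           norm (N_part \<Omega> r z X) / bdist \<Omega> z
             + 1 / C * (norm (H_part \<Omega> r z X) / bdist \<Omega> z powr (1 / real m)) \<le> K z X \<and>
           K z X \<le> norm (N_part \<Omega> r z X) / bdist \<Omega> z
             + C * (norm (H_part \<Omega> r z X) / bdist \<Omega> z powr (1 / 2))"
    using assms(4) unfolding catlin_type_metric_def by blast
  \<comment> \<open>The cover provides unique nearest points on each \<open>U i\<close>, and the
    collar lies in their union.\<close>
  have unique: "\<exists>!p. is_nearest \<Omega> z p" if z: "z \<in> collar \<Omega> \<epsilon>" for z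
  proof -
    obtain i where "i < s" "z \<in> U i"
      using z \<epsilon>(2) by blast
    moreover have "z \<in> \<Omega>"
      using z by (simp add: collar_def)
    ultimately show ?thesis
      using cover unfolding catlin_cover_def by blast
  qed
  have "\<exists>C'. \<forall>x\<in>\<Omega>. \<forall>y\<in>\<Omega>. g_fn \<Omega> m x y - C' \<le> finsler_dist \<Omega> K x y"
    by (rule finsler_dist_lower_bound
        [OF dom finsler nonneg finite_type_ge_1 [OF dom assms(3)] \<epsilon>(1) C])
      (use unique bounds in auto)
  then obtain C1 where C1: "\<And>x y. x \<in> \<Omega> \<Longrightarrow> y \<in> \<Omega> \<Longrightarrow> g_fn \<Omega> m x y - C1 \<le> finsler_dist \<Omega> K x y"
    by blast
  have "\<exists>C'. \<forall>x\<in>\<Omega>. \<forall>y\<in>\<Omega>. finsler_dist \<Omega> K x y \<le> g_fn \<Omega> 1 x y + C'"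
    by (rule finsler_dist_upper_bound [OF dom finsler nonneg \<epsilon>(1) C])
      (use unique bounds in auto)
  then obtain C2 where C2: "\<And>x y. x \<in> \<Omega> \<Longrightarrow> y \<in> \<Omega> \<Longrightarrow> finsler_dist \<Omega> K x y \<le> g_fn \<Omega> 1 x y + C2"
    by blast
  show ?thesis
  proof (intro exI [of _ "max 1 (max C1 C2)"] conjI ballI)
    fix x y assume xy: "x \<in> \<Omega>" "y \<in> \<Omega>"
    show "g_fn \<Omega> m x y - max 1 (max C1 C2) \<le> finsler_dist \<Omega> K x y"
      "finsler_dist \<Omega> K x y \<le> g_fn \<Omega> 1 x y + max 1 (max C1 C2)"
      using C1 [OF xy] C2 [OF xy] by linarith+
  qed simp
qed

end
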